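(* Define $P_t,\hat\mu_t$ by the forward recursion and $V_t,v_t$ by the backward recursion given in the context, and assume that all matrices inverted in these recursions, as well as $P_t^{-1}-\mu V_t$, are invertible. Let $p=(p_{x_0},\dots,p_{x_T},p_{u_t},\dots,p_{u_{T-1}})$ satisfy the first $t\,n_x$ rows (block rows of $x_0,\dots,x_{t-1}$) and the last $(T-t)(n_x+n_u)$ rows (block rows of $x_{t+1},\dots,x_T,u_t,\dots,u_{T-1}$) of the Newton system $\nabla^2J\,p=-\nabla J$. Then the remaining rows, from $t\,n_x+1$ to $(t+1)n_x$ (the block row of $x_t$), are equivalent to $$p_{x_t}=\left(P_t^{-1}-\mu V_t\right)^{-1}\left(P_t^{-1}\hat\mu_t+\mu v_t\right).$$
   Context: Setting. Let $T\ge 1$ and $0\le t\le T$ be integers and $\mu>0$. States $x_j\in\mathbb R^{n_x}$, controls $u_j\in\mathbb R^{n_u}$, measurements $y_j\in\mathbb{R}^{n_y}$. The maps $f_j:\mathbb R^{n_x}\times\mathbb R^{n_u}\to\mathbb R^{n_x}$ ($0\le j<T$), $h_j:\mathbb R^{n_x}\to\mathbb R^{n_y}$ ($1\le j\le t$), $\ell_j:\mathbb R^{n_x}\times\mathbb R^{n_u}\to\mathbb R$ ($0\le j<T$), $\ell_T:\mathbb R^{n_x}\to\mathbb R$ are $\mathcal C^2$. The matrices $P$, $Q_j$ ($1\le j\le T$), $R_j$ ($1\le j\le t$) are symmetric positive definite. The past controls $u_0,\dots,u_{t-1}$, the measurements $y_1,\dots,y_t$ and the prior $\hat x_0$ are given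 and fixed. Define the function of the variables $x_{0:T}=(x_0,\dots,x_T)$ and $u_{t:T-1}=(u_t,\dots,u_{T-1})$ \begin{align*} J(x_{0:T},u_{t:T-1}) &= \sum_{j=0}^{T-1}\ell_j(x_j,u_j)+\ell_T(x_T) - \tfrac1{2\mu}(x_0-\hat x_0)^TP^{-1}(x_0-\hat x_0)\\ &\quad - \tfrac1{2\mu}\sum_{j=1}^t (y_j-h_j(x_j))^TR_j^{-1}(y_j-h_j(x_j))\\ &\quad - \tfrac1{2\mu}\sum_{j=0}^{T-1}(x_{j+1}-f_j(x_j,u_j))^TQ_{j+1}^{-1}(x_{j+1}-f_j(x_j,u_j)). \end{align*} Fix a current iterate $(x^i_{0:T},u^i_{t:T-1})$ (with $u^i_k=u_k$ for $k<t$). All derivatives below, and $\nabla J,\nabla^2 J$, are evaluated at this iterate. The Newton step is $p=(p_{x_{0:T}},p_{u_{t:T-1}})$, with $p_{x_k}\in\mathbb R^{n_x}$, $p_{u_k}\in\mathbb R^{n_u}$, satisfying $\nabla^2 J\,p=-\nabla J$, with the variables ordered as $(x_0,\dots,x_T,u_t,\dots,u_{T-1})$. Notation. Superscripts denote derivatives: $f^x_k,f^u_k,h^x_k$ are Jacobian matrices; $\ell^x_k,\ell^u_k$ are gradient column vectors; $\ell^{xx}_k,\ell^{uu}_k,\ell^{xu}_k,\ell^{ux}_k=(\ell^{xu}_k)^T$ are blocks of the Hessian ($\ell_k^{ux}$ has size $n_u\times n_x$). Put $w^i_{k+1}=x^i_{k+1}-f_k(x^i_k,u^i_k)$ and $\gamma^i_k=y_k-h_k(x^i_k)$.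 For a vector $a$ and a vector-valued function $\phi$, $a^T\phi^{xx}=\sum_m a_m\phi_m^{xx}$ (weighted sum of the Hessians of the components), and similarly for $\phi^{xu},\phi^{uu}$. For $k<T$ define \begin{align*} \bar\ell^{xx}_k&=\ell^{xx}_k+\mu^{-1}{w^i_{k+1}}^TQ_{k+1}^{-1}f^{xx}_k+\mu^{-1}\mathbf 1_{1\le k\le t}\,{\gamma^i_k}^TR_k^{-1}h^{xx}_k,\\ \bar\ell^{xu}_k&=(\bar\ell^{ux}_k)^T=\ell^{xu}_k+\mu^{-1}{w^i_{k+1}}^TQ_{k+1}^{-1}f^{xu}_k,\\ \bar\ell^{uu}_k&=\ell^{uu}_k+\mu^{-1}{w^i_{k+1}}^TQ_{k+1}^{-1}f^{uu}_k, \end{align*} where $\mathbf 1_{1\le k\le t}$ equals $1$ if $1\le k\le t$ and $0$ otherwise. Forward recursion. $P_0=P$, $\hat\mu_0=\hat x_0-x_0^i$, and for $k=0,\dots,t-1$: \begin{align*} E_{k+1} &= P_k^{-1} + {f^x_k}^T Q_{k+1}^{-1} f^x_k - \mu\bar\ell^{xx}_k,\\ \bar P_{k+1} &= Q_{k+1} + f^x_k(P_k^{-1}-\mu\bar\ell^{xx}_k)^{-1}{f^x_k}^T,\\ K_{k+1} &= \bar P_{k+1}{h^x_{k+1}}^T(R_{k+1}+h^x_{k+1}\bar P_{k+1}{h^x_{k+1}}^T)^{-1},\\ P_{k+1} &= (I_{n_x}-K_{k+1}h^x_{k+1})\bar P_{k+1},\\ \hat\mu_{k+1} &= (I_{n_x}-K_{k+1}h^x_{k+1})(f^x_k\hat\mu_k-w^i_{k+1})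 + K_{k+1}\gamma^i_{k+1} + \mu P_{k+1}Q_{k+1}^{-1}f^x_kE_{k+1}^{-1}(\bar\ell^{xx}_k\hat\mu_k+\ell^x_k). \end{align*} Backward recursion. $V_T=\ell^{xx}_T$, $v_T=\ell^x_T$, and for $k=T-1,\dots,t$: \begin{align*} \Gamma_{k+1} &= I_{n_x} - \mu V_{k+1} Q_{k+1},\\ Q_{uu}^{(k)} &= \bar\ell^{uu}_k + {f^u_k}^T \Gamma_{k+1}^{-1} V_{k+1} f^u_k,\\ Q_{ux}^{(k)} &= \bar\ell^{ux}_k + {f^u_k}^T \Gamma_{k+1}^{-1} V_{k+1} f^x_k,\\ Q_{u}^{(k)} &= \ell^{u}_k + {f^u_k}^T \Gamma_{k+1}^{-1}(v_{k+1} - V_{k+1} w^i_{k+1}),\\ G_k &= -(Q_{uu}^{(k)})^{-1} Q_{ux}^{(k)},\qquad g_k = -(Q_{uu}^{(k)})^{-1} Q_u^{(k)},\\ V_k &= \bar\ell^{xx}_k + {f^x_k}^T \Gamma_{k+1}^{-1} V_{k+1} f^x_k + {Q_{ux}^{(k)}}^T G_k,\\ v_k &= \ell^x_k + {f^x_k}^T \Gamma_{k+1}^{-1}(v_{k+1} - V_{k+1} w^i_{k+1}) + {Q_{ux}^{(k)}}^T g_k. \end{align*}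
   Formalization: For t = T the claim as stated is false; the terminal value V_T is corrected to ℓ_T^{xx} + μ^{-1} γ_T^T R_T^{-1} h_T^{xx} in that case, while for t < T it is V_T = ℓ_T^{xx} as stated. *)

theory Defs
  imports "HOL-Analysis.Analysis"
begin

section \<open>Calculus and matrix notions\<close>

definition C2 :: "('a::real_normed_vector \<Rightarrow> 'b::real_normed_vector) \<Rightarrow> bool" where
  "C2 f \<longleftrightarrow> (\<exists>(f' :: 'a \<Rightarrow> 'a \<Rightarrow>\<^sub>L 'b) (f'' :: 'a \<Rightarrow> 'a \<Rightarrow>\<^sub>L 'a \<Rightarrow>\<^sub>L 'b).
     (\<forall>x. (f has_derivative blinfun_apply (f' x)) (at x)) \<and>
     (\<forall>x. (f' has_derivative blinfun_apply (f'' x)) (at x)) \<and>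
     continuous_on UNIV f'')"

definition grad :: "(real^'n \<Rightarrow> real) \<Rightarrow> real^'n \<Rightarrow> real^'n" where
  "grad \<phi> x = (\<chi> i. frechet_derivative \<phi> (at x) (axis i 1))"

definition hess :: "(real^'n \<Rightarrow> real) \<Rightarrow> real^'n \<Rightarrow> real^'n^'n" where
  "hess \<phi> x = jacobian (grad \<phi>) (at x)"

text \<open>The \<open>xu\<close> block of the Hessian of \<open>\<phi>\<close>: rows are indexed by the
  components of \<open>x\<close>, columns by the components of \<open>u\<close>.\<close>

definition hess_xu :: "(real^'n \<Rightarrow> real^'m \<Rightarrow> real) \<Rightarrow> real^'n \<Rightarrow> real^'m \<Rightarrow> real^'m^'n" where
  "hess_xu \<phi> x u = jacobian (\<lambda>v. grad (\<lambda>\<xi>. \<phi> \<xi> v) x) (at u)"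

text \<open>Hessians of vector-valued maps, contracted with a weight vector \<open>a\<close> over the
  components of the value.\<close>

definition whess :: "real^'k \<Rightarrow> (real^'n \<Rightarrow> real^'k) \<Rightarrow> real^'n \<Rightarrow> real^'n^'n" where
  "whess a \<phi> x = (\<Sum>m\<in>UNIV. a $ m *\<^sub>R hess (\<lambda>\<xi>. \<phi> \<xi> $ m) x)"

definition whess_xu ::
  "real^'k \<Rightarrow> (real^'n \<Rightarrow> real^'m \<Rightarrow> real^'k) \<Rightarrow> real^'n \<Rightarrow> real^'m \<Rightarrow> real^'m^'n" where
  "whess_xu a \<phi> x u = (\<Sum>m\<in>UNIV. a $ m *\<^sub>R hess_xu (\<lambda>\<xi> v. \<phi> \<xi> v $ m) x u)"

definition sym_pos_def :: "real^'n^'n \<Rightarrow> bool" where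
  "sym_pos_def A \<longleftrightarrow> transpose A = A \<and> (\<forall>v. v \<noteq> 0 \<longrightarrow> v \<bullet> (A *v v) > 0)"

section \<open>The problem\<close>

text \<open>Index ranges that carry meaning: \<open>dyn\<close> and \<open>cost\<close> for \<open>j < hor\<close>; \<open>meas\<close>, \<open>Rcov\<close>
  and \<open>yobs\<close> for \<open>1 \<le> j \<le> cur\<close>; \<open>Qcov\<close> for \<open>1 \<le> j \<le> hor\<close>; \<open>upast\<close> for \<open>j < cur\<close>.
  Here \<open>hor\<close> is the horizon \<open>T\<close> and \<open>cur\<close> the current time \<open>t\<close>.\<close>

record ('x, 'u, 'y) problem =
  hor :: nat
  cur :: nat
  mu :: real
  dyn :: "nat \<Rightarrow> real^('x::finite) \<Rightarrow> real^('u::finite) \<Rightarrow> real^'x"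
  meas :: "nat \<Rightarrow> real^'x \<Rightarrow> real^('y::finite)"
  cost :: "nat \<Rightarrow> real^'x \<Rightarrow> real^'u \<Rightarrow> real"
  fcost :: "real^'x \<Rightarrow> real"
  Pcov :: "real^'x^'x"
  Qcov :: "nat \<Rightarrow> real^'x^'x"
  Rcov :: "nat \<Rightarrow> real^'y^'y"
  upast :: "nat \<Rightarrow> real^'u"
  yobs :: "nat \<Rightarrow> real^'y"
  xprior :: "real^'x"

text \<open>A point \<open>(x_{0:T}, u_{t:T-1})\<close> is given by its scalar coordinates; only the
  coordinates in \<open>decision\<close> below are variables.\<close>

datatype ('x, 'u) coord = State nat 'x | Control nat 'u

type_synonym ('x, 'u) point = "('x, 'u) coord \<Rightarrow> real"

definition decision :: "('x::finite, 'u::finite, 'y::finite) problem \<Rightarrow> ('x, 'u) coord set" where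
  "decision D = {State k a | k a. k \<le> hor D} \<union> {Control k b | k b. cur D \<le> k \<and> k < hor D}"

definition st :: "('x::finite, 'u) point \<Rightarrow> nat \<Rightarrow> real^'x" where
  "st z k = (\<chi> a. z (State k a))"

definition ct :: "('x::finite, 'u::finite, 'y::finite) problem \<Rightarrow> ('x, 'u) point \<Rightarrow> nat \<Rightarrow> real^'u" where
  "ct D z k = (if k < cur D then upast D k else (\<chi> b. z (Control k b)))"

definition resid :: "('x::finite, 'u::finite, 'y::finite) problem \<Rightarrow> ('x, 'u) point \<Rightarrow> nat \<Rightarrow> real^'x" where
  "resid D z k = st z k - dyn D (k - 1) (st z (k - 1)) (ct D z (k - 1))"  \<comment> \<open>\<open>w_k\<close>, for \<open>k \<ge> 1\<close>\<close>

definition innov :: "('x::finite, 'u::finite, 'y::finite) problem \<Rightarrow> ('x, 'u) point \<Rightarrow> nat \<Rightarrow> real^'y" where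
  "innov D z k = yobs D k - meas D k (st z k)"  \<comment> \<open>\<open>\<gamma>_k\<close>\<close>

definition J :: "('x::finite, 'u::finite, 'y::finite) problem \<Rightarrow> ('x, 'u) point \<Rightarrow> real" where
  "J D z =
     (\<Sum>j<hor D. cost D j (st z j) (ct D z j)) + fcost D (st z (hor D))
     - 1 / (2 * mu D) * ((st z 0 - xprior D) \<bullet> (matrix_inv (Pcov D) *v (st z 0 - xprior D)))
     - 1 / (2 * mu D) * (\<Sum>j=1..cur D.
         (yobs D j - meas D j (st z j)) \<bullet>
           (matrix_inv (Rcov D j) *v (yobs D j - meas D j (st z j))))
     - 1 / (2 * mu D) * (\<Sum>j<hor D.
         (st z (Suc j) - dyn D j (st z j) (ct D z j)) \<bullet>
           (matrix_inv (Qcov D (Suc j)) *v (st z (Suc j) - dyn D j (st z j) (ct D z j))))"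

definition gradJ :: "('x::finite, 'u::finite, 'y::finite) problem \<Rightarrow> ('x, 'u) coord \<Rightarrow> ('x, 'u) point \<Rightarrow> real" where
  "gradJ D c z = deriv (\<lambda>s. J D (z(c := s))) (z c)"

definition hessJ :: "('x::finite, 'u::finite, 'y::finite) problem \<Rightarrow>
    ('x, 'u) coord \<Rightarrow> ('x, 'u) coord \<Rightarrow> ('x, 'u) point \<Rightarrow> real" where
  "hessJ D c d z = deriv (\<lambda>s. gradJ D c (z(d := s))) (z d)"

text \<open>The scalar row with index \<open>c\<close> of the Newton system at the iterate \<open>z\<close>.\<close>

definition newton_row :: "('x::finite, 'u::finite, 'y::finite) problem \<Rightarrow>
    ('x, 'u) point \<Rightarrow> ('x, 'u) point \<Rightarrow> ('x, 'u) coord \<Rightarrow> bool" where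
  "newton_row D z p c \<longleftrightarrow> (\<Sum>d\<in>decision D. hessJ D c d z * p d) = - gradJ D c z"

section \<open>Derivatives at the iterate\<close>

context
  fixes D :: "('x::finite, 'u::finite, 'y::finite) problem" and z :: "('x, 'u) point"
begin

definition fx :: "nat \<Rightarrow> real^'x^'x" where
  "fx k = jacobian (\<lambda>x. dyn D k x (ct D z k)) (at (st z k))"

definition fu :: "nat \<Rightarrow> real^'u^'x" where
  "fu k = jacobian (\<lambda>u. dyn D k (st z k) u) (at (ct D z k))"

definition hx :: "nat \<Rightarrow> real^'x^'y" where
  "hx k = jacobian (meas D k) (at (st z k))"

definition lx :: "nat \<Rightarrow> real^'x" where
  "lx k = grad (\<lambda>x. cost D k x (ct D z k)) (st z k)"

definition lu :: "nat \<Rightarrow> real^'u" where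
  "lu k = grad (\<lambda>u. cost D k (st z k) u) (ct D z k)"

definition wQ :: "nat \<Rightarrow> real^'x" where
  "wQ k = resid D z k v* matrix_inv (Qcov D k)"  \<comment> \<open>the row vector \<open>w_k^T Q_k^{-1}\<close>\<close>

definition meas_curv :: "nat \<Rightarrow> real^'x^'x" where
  "meas_curv k =
     (if 1 \<le> k \<and> k \<le> cur D
      then (1 / mu D) *\<^sub>R whess (innov D z k v* matrix_inv (Rcov D k)) (meas D k) (st z k)
      else 0)"

definition lbar_xx :: "nat \<Rightarrow> real^'x^'x" where
  "lbar_xx k = hess (\<lambda>x. cost D k x (ct D z k)) (st z k)
     + (1 / mu D) *\<^sub>R whess (wQ (Suc k)) (\<lambda>x. dyn D k x (ct D z k)) (st z k)
     + meas_curv k"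

definition lbar_xu :: "nat \<Rightarrow> real^'u^'x" where
  "lbar_xu k = hess_xu (cost D k) (st z k) (ct D z k)
     + (1 / mu D) *\<^sub>R whess_xu (wQ (Suc k)) (dyn D k) (st z k) (ct D z k)"

definition lbar_uu :: "nat \<Rightarrow> real^'u^'u" where
  "lbar_uu k = hess (\<lambda>u. cost D k (st z k) u) (ct D z k)
     + (1 / mu D) *\<^sub>R whess (wQ (Suc k)) (\<lambda>u. dyn D k (st z k) u) (ct D z k)"

section \<open>Forward recursion\<close>

text \<open>\<open>Emat k Pk\<close>, \<open>Pbar k Pk\<close>, \<open>Sinn k Pk\<close>, \<open>Kgain k Pk\<close> carry the mathematical index
  \<open>k + 1\<close> and depend on \<open>P_k = Pk\<close>; \<open>Sinn\<close> is the matrix inverted in the gain.\<close>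

definition Emat :: "nat \<Rightarrow> real^'x^'x \<Rightarrow> real^'x^'x" where
  "Emat k Pk = matrix_inv Pk + transpose (fx k) ** matrix_inv (Qcov D (Suc k)) ** fx k
     - mu D *\<^sub>R lbar_xx k"

definition Pbar :: "nat \<Rightarrow> real^'x^'x \<Rightarrow> real^'x^'x" where
  "Pbar k Pk = Qcov D (Suc k)
     + fx k ** matrix_inv (matrix_inv Pk - mu D *\<^sub>R lbar_xx k) ** transpose (fx k)"

definition Sinn :: "nat \<Rightarrow> real^'x^'x \<Rightarrow> real^'y^'y" where
  "Sinn k Pk = Rcov D (Suc k) + hx (Suc k) ** Pbar k Pk ** transpose (hx (Suc k))"

definition Kgain :: "nat \<Rightarrow> real^'x^'x \<Rightarrow> real^'y^'x" where
  "Kgain k Pk = Pbar k Pk ** transpose (hx (Suc k)) ** matrix_inv (Sinn k Pk)"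

primrec fwdP :: "nat \<Rightarrow> real^'x^'x" where
  "fwdP 0 = Pcov D"
| "fwdP (Suc k) = (mat 1 - Kgain k (fwdP k) ** hx (Suc k)) ** Pbar k (fwdP k)"

primrec fwdm :: "nat \<Rightarrow> real^'x" where
  "fwdm 0 = xprior D - st z 0"
| "fwdm (Suc k) =
     (mat 1 - Kgain k (fwdP k) ** hx (Suc k)) *v (fx k *v fwdm k - resid D z (Suc k))
     + Kgain k (fwdP k) *v innov D z (Suc k)
     + mu D *\<^sub>R ((fwdP (Suc k) ** matrix_inv (Qcov D (Suc k)) ** fx k
                  ** matrix_inv (Emat k (fwdP k))) *v (lbar_xx k *v fwdm k + lx k))"

section \<open>Backward recursion\<close>

text \<open>In the following \<open>V\<close> and \<open>v\<close> stand for \<open>V_{k+1}\<close> and \<open>v_{k+1}\<close>.\<close>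

definition Gam :: "nat \<Rightarrow> real^'x^'x \<Rightarrow> real^'x^'x" where
  "Gam k V = mat 1 - mu D *\<^sub>R (V ** Qcov D (Suc k))"

definition Quu :: "nat \<Rightarrow> real^'x^'x \<Rightarrow> real^'u^'u" where
  "Quu k V = lbar_uu k + transpose (fu k) ** matrix_inv (Gam k V) ** V ** fu k"

definition Qux :: "nat \<Rightarrow> real^'x^'x \<Rightarrow> real^'x^'u" where
  "Qux k V = transpose (lbar_xu k) + transpose (fu k) ** matrix_inv (Gam k V) ** V ** fx k"

definition Qu :: "nat \<Rightarrow> real^'x^'x \<Rightarrow> real^'x \<Rightarrow> real^'u" where
  "Qu k V v = lu k
     + (transpose (fu k) ** matrix_inv (Gam k V)) *v (v - V *v resid D z (Suc k))"

definition Ggain :: "nat \<Rightarrow> real^'x^'x \<Rightarrow> real^'x^'u" where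
  "Ggain k V = - (matrix_inv (Quu k V) ** Qux k V)"

definition gvec :: "nat \<Rightarrow> real^'x^'x \<Rightarrow> real^'x \<Rightarrow> real^'u" where
  "gvec k V v = - (matrix_inv (Quu k V) *v Qu k V v)"

text \<open>The term \<open>meas_curv (hor D)\<close> in the initialisation vanishes unless \<open>cur D = hor D\<close>,
  so that \<open>V_T\<close> is the Hessian of the final cost whenever \<open>t < T\<close>.  For \<open>t = T\<close> it is the
  second-order part of the last measurement term of \<open>J\<close>, which \<open>lbar_xx\<close> contains for all
  earlier measurements, and without it the characterisation of the Newton step fails.\<close>

function bwdV :: "nat \<Rightarrow> real^'x^'x" where
  "bwdV k =
     (if k < hor D then
        lbar_xx k
        + transpose (fx k) ** matrix_inv (Gam k (bwdV (Suc k))) ** bwdV (Suc k) ** fx k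
        + transpose (Qux k (bwdV (Suc k))) ** Ggain k (bwdV (Suc k))
      else hess (fcost D) (st z (hor D)) + meas_curv (hor D))"
  by auto
termination by (relation "Wellfounded.measure (\<lambda>k. hor D - k)") auto

function bwdv :: "nat \<Rightarrow> real^'x" where
  "bwdv k =
     (if k < hor D then
        lx k
        + (transpose (fx k) ** matrix_inv (Gam k (bwdV (Suc k))))
            *v (bwdv (Suc k) - bwdV (Suc k) *v resid D z (Suc k))
        + transpose (Qux k (bwdV (Suc k))) *v gvec k (bwdV (Suc k)) (bwdv (Suc k))
      else grad (fcost D) (st z (hor D)))"
  by auto
termination by (relation "Wellfounded.measure (\<lambda>k. hor D - k)") auto

end

declare bwdV.simps [simp del] bwdv.simps [simp del]

lemma bwdV_final: "cur D < hor D \<Longrightarrow> bwdV D z (hor D) = hess (fcost D) (st z (hor D))"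
  by (subst bwdV.simps) (simp add: meas_curv_def)

end

theory Submission
  imports Defs
begin

text \<open>
  Let \<open>\<lambda>\<^sub>k\<close> be \<open>\<mu>\<^sup>-\<^sup>1\<close> times the inverse of \<open>Q\<close> at index \<open>k + 1\<close> applied to the linearised dynamics
  residual (\<open>costate k\<close> below). The block row of \<open>x\<^sub>k\<close> splits as \<open>past k + future k = 0\<close>, where
  \<open>past k\<close> collects minus the preceding costate (or the prior, for \<open>k = 0\<close>) and the first-order part
  of the measurement at time \<open>k\<close>, and \<open>future k\<close> collects the stage cost, all curvature terms and
  \<open>\<lambda>\<^sub>k\<close>. Eliminating \<open>x\<^sub>0, x\<^sub>1, \<dots>\<close> forwards, with the Woodbury identity at each step, gives
  \<open>past k = - \<mu>\<^sup>-\<^sup>1 P\<^sub>k\<^sup>-\<^sup>1 (p\<^sub>k - m\<^sub>k)\<close> for \<open>k \<le> t\<close>, where \<open>m\<^sub>k\<close> is the vector \<open>fwdm\<close> of the forward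
  recursion. Eliminating states and controls backwards from \<open>T\<close> gives \<open>future k = V\<^sub>k p\<^sub>k + v\<^sub>k\<close> for
  \<open>k \<ge> t\<close>; this step needs \<open>V\<^sub>k\<close> to be symmetric, hence Schwarz's theorem for the second
  derivatives. The row of \<open>x\<^sub>t\<close> is the sum of the two expressions.
\<close>

section \<open>Matrix identities of the two recursions\<close>

lemma matrix_inv_inverse:
  fixes A :: "real^'n^'n"
  assumes "invertible A"
  shows "A ** matrix_inv A = mat 1" and "matrix_inv A ** A = mat 1"
  using assms unfolding invertible_def matrix_inv_def
  by (metis (mono_tags, lifting) someI_ex)+

lemma matrix_inv_cancel:
  fixes A :: "real^'n^'n"
  assumes "invertible A"
  shows "A *v (matrix_inv A *v x) = x" and "matrix_inv A *v (A *v x) = x"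
  using matrix_inv_inverse[OF assms] by (simp_all add: matrix_vector_mul_assoc)

lemma matrix_inv_eqI:
  fixes A :: "real^'n^'n"
  assumes "A ** B = mat 1"
  shows "invertible A" and "matrix_inv A = B"
proof -
  show inv: "invertible A"
    using assms by (auto simp: invertible_right_inverse)
  have "matrix_inv A = matrix_inv A ** (A ** B)"
    by (simp add: assms)
  also have "\<dots> = B"
    by (simp add: matrix_mul_assoc matrix_inv_inverse[OF inv])
  finally show "matrix_inv A = B" .
qed

lemma transpose_add: "transpose (A + B) = transpose A + transpose B"
  by (vector transpose_def)

lemma transpose_diff: "transpose (A - B) = transpose A - transpose B"
  for A B :: "real^'n^'m"
  by (vector transpose_def)

lemma uminus_matrix_vector_mult: "(- A) *v x = - (A *v x)"
  for A :: "real^'n^'m"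
  by (simp add: vec_eq_iff matrix_vector_mult_def sum_negf)

lemma matrix_vector_mult_uminus: "A *v (- x) = - (A *v x)"
  for A :: "real^'n^'m"
  by (simp add: vec_eq_iff matrix_vector_mult_def sum_negf)

lemma symmetric_matrix_inv:
  fixes A :: "real^'n^'n"
  assumes "invertible A" and "transpose A = A"
  shows "transpose (matrix_inv A) = matrix_inv A"
proof -
  have "A ** transpose (matrix_inv A) = mat 1"
    using matrix_inv_inverse(2)[OF assms(1)] assms(2)
    by (metis matrix_transpose_mul transpose_mat)
  then show ?thesis
    using matrix_inv_eqI by metis
qed

lemma sym_pos_def_invertible:
  fixes A :: "real^'n^'n"
  assumes "sym_pos_def A"
  shows "invertible A"
proof -
  have "x = 0" if "A *v x = 0" for x
    using assms that unfolding sym_pos_def_def by force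
  then show ?thesis
    by (simp add: invertible_left_inverse matrix_left_invertible_ker)
qed

section \<open>Woodbury's identity and single steps of the two recursions, checked on
  vectors\<close>

lemmas matrix_vector_simps =
  matrix_vector_mul_assoc[symmetric] scaleR_matrix_vector_assoc[symmetric]
  matrix_vector_mult_scaleR uminus_matrix_vector_mult matrix_vector_mult_uminus
  matrix_vector_mult_add_rdistrib matrix_vector_mult_diff_rdistrib
  matrix_vector_right_distrib matrix_vector_mult_diff_distrib

text \<open>For a vector \<open>y\<close> let \<open>u\<close> solve (A + G Q^-1 F) u = G Q^-1 y.
  Then \<open>W *v y\<close> is Q^-1 (y - F u), and \<open>G\<close> maps it to A u, so the first
  factor maps it to y - F u + F u. A product equal to \<open>mat 1\<close> yields, by
  \<open>matrix_inv_eqI\<close>, both the invertibility of that factor and its inverse.\<close>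

lemma woodbury:
  fixes Q :: "real^'n^'n" and A :: "real^'m^'m"
  assumes Q: "invertible Q" and A: "invertible A"
    and E: "invertible (A + G ** matrix_inv Q ** F)"
  defines "W \<equiv> matrix_inv Q
    - matrix_inv Q ** F ** matrix_inv (A + G ** matrix_inv Q ** F) ** G ** matrix_inv Q"
  shows "(Q + F ** matrix_inv A ** G) ** W = mat 1"
proof -
  have "((Q + F ** matrix_inv A ** G) ** W) *v y = mat 1 *v y" for y
  proof -
    define u where
      "u = matrix_inv (A + G ** matrix_inv Q ** F) *v (G *v (matrix_inv Q *v y))"
    have "A *v u + G *v (matrix_inv Q *v (F *v u)) = G *v (matrix_inv Q *v y)"
      using matrix_inv_cancel(1)[OF E, of "G *v (matrix_inv Q *v y)"]
      by (simp add: u_def matrix_vector_simps)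
    then have *: "G *v (matrix_inv Q *v (F *v u)) = G *v (matrix_inv Q *v y) - A *v u"
      by (simp add: algebra_simps)
    have "W *v y = matrix_inv Q *v y - matrix_inv Q *v (F *v u)"
      by (simp add: W_def u_def matrix_vector_simps)
    then have "((Q + F ** matrix_inv A ** G) ** W) *v y
        = Q *v (matrix_inv Q *v y - matrix_inv Q *v (F *v u))
          + F *v (matrix_inv A *v (G *v (matrix_inv Q *v y - matrix_inv Q *v (F *v u))))"
      by (simp add: matrix_vector_simps)
    also have "\<dots> = y"
      by (simp add: matrix_vector_simps matrix_inv_cancel[OF Q] matrix_inv_cancel[OF A] *)
    finally show ?thesis by simp
  qed
  then show ?thesis
    unfolding matrix_eq by blast
qed

text \<open>The Kalman update in information form: two uses of Woodbury give \<open>P'\<close> the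
  inverse W + H^T R^-1 H, with \<open>W\<close> the inverse of \<open>B\<close>. The row
  \<open>stationary\<close> of the current state is solved for \<open>q\<close> through
  \<open>E\<close>; after substitution \<open>q\<close> is gone and the inverse of \<open>P'\<close>
  applied to q' - m' remains. In the induction this is minus \<mu> times \<open>past\<close> at the
  next time.\<close>

lemma forward_step:
  fixes P L F Q B E P' :: "real^'n^'n" and H :: "real^'n^'m" and R S :: "real^'m^'m"
    and K :: "real^'m^'n" and q m w l q' m' :: "real^'n" and y :: "real^'m"
  assumes P: "invertible P" and A: "invertible (matrix_inv P - \<mu> *\<^sub>R L)"
    and E: "invertible E" and S: "invertible S" and Q: "invertible Q" and R: "invertible R"
    and E_def: "E = matrix_inv P + transpose F ** matrix_inv Q ** F - \<mu> *\<^sub>R L"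
    and B_def: "B = Q + F ** matrix_inv (matrix_inv P - \<mu> *\<^sub>R L) ** transpose F"
    and S_def: "S = R + H ** B ** transpose H"
    and K_def: "K = B ** transpose H ** matrix_inv S"
    and P'_def: "P' = (mat 1 - K ** H) ** B"
    and m'_def: "m' = (mat 1 - K ** H) *v (F *v m - w) + K *v y
      + \<mu> *\<^sub>R ((P' ** matrix_inv Q ** F ** matrix_inv E) *v (L *v m + l))"
    and stationary: "transpose F *v (matrix_inv Q *v (q' - F *v q + w))
      = matrix_inv P *v (q - m) - \<mu> *\<^sub>R (L *v q + l)"
  shows "invertible P'"
    and "matrix_inv Q *v (q' - F *v q + w) - transpose H *v (matrix_inv R *v (y - H *v q'))
      = matrix_inv P' *v (q' - m')"
proof -
  note [simp del] = transpose_matrix_vector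
  define X where "X = matrix_inv Q"
  define W where "W = X - X ** F ** matrix_inv E ** transpose F ** X"
  have E_eq: "E = matrix_inv P - \<mu> *\<^sub>R L + transpose F ** X ** F"
    by (simp add: E_def X_def)
  \<comment> \<open>Woodbury for the prediction: the base matrix is P^-1 - \<mu> L, and the inner
    matrix is \<open>E\<close>.\<close>
  have BW: "B ** W = mat 1"
    using woodbury[OF Q A, of "transpose F" F] E
    unfolding W_def E_eq X_def B_def by simp
  note B = matrix_inv_eqI[OF BW]
  have W: "invertible W" "matrix_inv W = B"
    using matrix_inv_eqI[of W B] matrix_left_right_inverse[of B W] BW by auto
  have WB: "W ** B = mat 1"
    using BW by (simp add: matrix_left_right_inverse)
  have P'_eq: "P' = B - B ** transpose H ** matrix_inv S ** H ** B"
    unfolding matrix_eq by (simp add: P'_def K_def matrix_vector_simps)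
  \<comment> \<open>Woodbury for the measurement, with \<open>W\<close> in place of
    \<open>Q\<close>: the inverse of \<open>W\<close> is \<open>B\<close>, so the inner matrix is
    \<open>S\<close>.\<close>
  have "(W + transpose H ** matrix_inv R ** H) ** P' = mat 1"
    using woodbury[OF W(1) R, of H "transpose H"] S W(2)
    unfolding P'_eq S_def by simp
  then have P'C: "P' ** (W + transpose H ** matrix_inv R ** H) = mat 1"
    by (simp add: matrix_left_right_inverse)
  show P': "invertible P'"
    using matrix_inv_eqI(1)[OF P'C] .
  have P'i: "matrix_inv P' = W + transpose H ** matrix_inv R ** H"
    using matrix_inv_eqI(2)[OF P'C] .
  \<comment> \<open>Since P' = (I - K H) B, the factor I - K H equals P' W.\<close>
  have gain1: "matrix_inv P' *v ((mat 1 - K ** H) *v x) = W *v x" for x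
  proof -
    have "(mat 1 - K ** H) *v x = P' *v (W *v x)"
      using BW by (metis P'_def matrix_mul_assoc matrix_mul_rid matrix_vector_mul_assoc)
    then show ?thesis
      by (simp add: matrix_inv_cancel[OF P'])
  qed
  \<comment> \<open>The other form of the gain, P' H^T R^-1. Writing \<open>x\<close> as
    \<open>S\<close> applied to \<open>u\<close> splits it into an R part and an H B H^T
    part.\<close>
  have gain2: "matrix_inv P' *v (K *v x) = transpose H *v (matrix_inv R *v x)" for x
  proof -
    define u where "u = matrix_inv S *v x"
    have Su: "x = R *v u + H *v (B *v (transpose H *v u))"
      using matrix_inv_cancel(1)[OF S, of x] unfolding u_def[symmetric]
      by (simp add: S_def matrix_vector_simps)
    have WBv: "W *v (B *v b) = b" for b
      by (simp add: matrix_vector_mul_assoc WB)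
    have "K *v x = B *v (transpose H *v u)"
      by (simp add: K_def u_def matrix_vector_simps)
    then have "matrix_inv P' *v (K *v x) = transpose H *v u
        + transpose H *v (matrix_inv R *v (H *v (B *v (transpose H *v u))))"
      using WBv by (simp add: P'i matrix_vector_simps)
    also have "\<dots> = transpose H *v (matrix_inv R *v x)"
      by (simp add: Su matrix_vector_simps matrix_inv_cancel[OF R])
    finally show ?thesis .
  qed
  have Eq: "E *v q = matrix_inv P *v m + \<mu> *\<^sub>R l + transpose F *v (X *v (q' + w))"
    using stationary by (simp add: E_def X_def[symmetric] matrix_vector_simps algebra_simps)
  then have q: "q = matrix_inv E *v (matrix_inv P *v m + \<mu> *\<^sub>R l
      + transpose F *v (X *v (q' + w)))"
    using matrix_inv_cancel(2)[OF E] by metis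
  have "E *v m = matrix_inv P *v m - \<mu> *\<^sub>R (L *v m) + transpose F *v (X *v (F *v m))"
    by (simp add: E_eq matrix_vector_simps)
  then have m: "m = matrix_inv E *v (matrix_inv P *v m - \<mu> *\<^sub>R (L *v m)
      + transpose F *v (X *v (F *v m)))"
    using matrix_inv_cancel(2)[OF E] by metis
  \<comment> \<open>Expressing \<open>m\<close> itself through \<open>E\<close> brings W F m to the
    shape of the correction term in \<open>m'\<close>. In their sum \<mu> L m cancels and P^-1 m +
    \<mu> l remains under E^-1.\<close>
  have Wm: "W *v (F *v m) = X *v (F *v (matrix_inv E *v (matrix_inv P *v m - \<mu> *\<^sub>R (L *v m))))"
  proof -
    have "X *v (F *v m) = X *v (F *v (matrix_inv E *v (matrix_inv P *v m - \<mu> *\<^sub>R (L *v m)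
        + transpose F *v (X *v (F *v m)))))"
      using m by simp
    then show ?thesis
      by (simp add: W_def matrix_vector_simps diff_eq_eq)
  qed
  have "matrix_inv P' *v m' = W *v (F *v m) - W *v w + transpose H *v (matrix_inv R *v y)
      + \<mu> *\<^sub>R (X *v (F *v (matrix_inv E *v (L *v m + l))))"
    unfolding m'_def
    by (simp add: matrix_vector_right_distrib gain1 gain2 matrix_vector_mult_scaleR
        matrix_vector_mul_assoc[symmetric] matrix_inv_cancel[OF P'] X_def[symmetric]
        matrix_vector_mult_diff_distrib)
  also have "\<dots> = X *v (F *v (matrix_inv E *v (matrix_inv P *v m + \<mu> *\<^sub>R l)))
      - W *v w + transpose H *v (matrix_inv R *v y)"
    unfolding Wm by (simp add: matrix_vector_simps algebra_simps)
  finally have P'm': "matrix_inv P' *v m' = \<dots>" .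
  \<comment> \<open>Substituting \<open>q\<close> turns \<open>X\<close> into \<open>W\<close>: the
    part of \<open>q\<close> driven by q' + w produces exactly the correction term of
    \<open>W\<close>.\<close>
  have "X *v (F *v q) = X *v (F *v (matrix_inv E *v (matrix_inv P *v m + \<mu> *\<^sub>R l
      + transpose F *v (X *v (q' + w)))))"
    using q by simp
  then have Wq: "X *v (q' + w) - X *v (F *v q)
      = W *v (q' + w) - X *v (F *v (matrix_inv E *v (matrix_inv P *v m + \<mu> *\<^sub>R l)))"
    by (simp add: W_def matrix_vector_simps)
  show "matrix_inv Q *v (q' - F *v q + w) - transpose H *v (matrix_inv R *v (y - H *v q'))
      = matrix_inv P' *v (q' - m')"
    using Wq unfolding matrix_vector_mult_diff_distrib[of "matrix_inv P'"] P'm'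
    by (simp add: P'i X_def[symmetric] matrix_vector_simps algebra_simps)
qed

text \<open>The next state \<open>q'\<close> contains \<mu> Q r, so r = V q' + v is an implicit
  equation for the costate, with matrix \<open>\<Gamma>\<close>. Solving it makes \<open>r\<close>
  affine in \<open>q\<close> and \<open>c\<close>, and the control row then determines
  \<open>c\<close> as a feedback of \<open>q\<close>. Symmetry belongs to the conclusion because the
  next step backwards relies on it: with \<Gamma>^-1 V symmetric, the coefficient of
  \<open>c\<close> in the state row is the transpose of \<open>Y\<close>.\<close>

lemma backward_step:
  fixes V Q L F \<Gamma> V' :: "real^'n^'n" and U Z :: "real^'m^'m"
    and N Fu :: "real^'m^'n" and Y :: "real^'n^'m"
    and q q' w l v r v' :: "real^'n" and c lc d :: "real^'m"
  assumes V: "transpose V = V" and Q: "transpose Q = Q"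
    and L: "transpose L = L" and U: "transpose U = U"
    and \<Gamma>: "invertible \<Gamma>" and Z: "invertible Z"
    and \<Gamma>_def: "\<Gamma> = mat 1 - \<mu> *\<^sub>R (V ** Q)"
    and Z_def: "Z = U + transpose Fu ** matrix_inv \<Gamma> ** V ** Fu"
    and Y_def: "Y = transpose N + transpose Fu ** matrix_inv \<Gamma> ** V ** F"
    and d_def: "d = lc + (transpose Fu ** matrix_inv \<Gamma>) *v (v - V *v w)"
    and V'_def: "V' = L + transpose F ** matrix_inv \<Gamma> ** V ** F
      + transpose Y ** (- (matrix_inv Z ** Y))"
    and v'_def: "v' = l + (transpose F ** matrix_inv \<Gamma>) *v (v - V *v w)
      + transpose Y *v (- (matrix_inv Z *v d))"
    and r: "r = V *v q' + v" and dynamics: "\<mu> *\<^sub>R (Q *v r) = q' - F *v q - Fu *v c + w"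
    and control: "lc + U *v c + transpose N *v q + transpose Fu *v r = 0"
  shows "transpose V' = V'"
    and "l + L *v q + N *v c + transpose F *v r = V' *v q + v'"
proof -
  note [simp del] = transpose_matrix_vector
  define M where "M = matrix_inv \<Gamma> ** V"
  \<comment> \<open>Both sides are V - \<mu> V Q V. Multiplying by \<Gamma>^-1 on the left and by
    its transpose on the right carries this symmetry over to \<open>M\<close>.\<close>
  have "\<Gamma> ** V = V ** transpose \<Gamma>"
    unfolding matrix_eq
    by (simp add: \<Gamma>_def V Q matrix_vector_simps transpose_diff transpose_scalar
        matrix_transpose_mul)
  then have "matrix_inv \<Gamma> ** (\<Gamma> ** V) ** transpose (matrix_inv \<Gamma>)
      = matrix_inv \<Gamma> ** (V ** transpose \<Gamma>) ** transpose (matrix_inv \<Gamma>)"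
    by simp
  moreover have "transpose \<Gamma> ** transpose (matrix_inv \<Gamma>) = mat 1"
    using matrix_inv_inverse(2)[OF \<Gamma>] by (metis matrix_transpose_mul transpose_mat)
  ultimately have "V ** transpose (matrix_inv \<Gamma>) = matrix_inv \<Gamma> ** V"
    by (metis matrix_inv_inverse(2)[OF \<Gamma>] matrix_mul_assoc matrix_mul_lid matrix_mul_rid)
  then have M: "transpose M = M"
    by (simp add: M_def matrix_transpose_mul V)
  have Y_eq: "transpose Y = N + transpose F ** M ** Fu"
    by (simp add: Y_def M_def[symmetric] matrix_mul_assoc[symmetric] transpose_add
        matrix_transpose_mul M)
  have Z_sym: "transpose Z = Z"
    unfolding Z_def matrix_mul_assoc[symmetric] M_def[symmetric]
    by (simp add: transpose_add matrix_transpose_mul M U matrix_mul_assoc)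
  have ZY: "transpose Y ** (- (matrix_inv Z ** Y)) = - (transpose Y ** matrix_inv Z ** Y)"
    unfolding matrix_eq by (simp add: matrix_vector_simps)
  show "transpose V' = V'"
    unfolding V'_def ZY
    by (simp add: M_def[symmetric] matrix_mul_assoc[symmetric] transpose_add transpose_diff
        matrix_transpose_mul M L symmetric_matrix_inv[OF Z Z_sym])
  have "\<Gamma> *v r = V *v (F *v q + Fu *v c - w) + v"
  proof -
    have "q' = F *v q + Fu *v c - w + \<mu> *\<^sub>R (Q *v r)"
      using dynamics by (simp add: algebra_simps)
    with r have "r = V *v (F *v q + Fu *v c - w + \<mu> *\<^sub>R (Q *v r)) + v"
      by simp
    then have "r - \<mu> *\<^sub>R (V *v (Q *v r)) = V *v (F *v q + Fu *v c - w) + v"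
      by (simp add: matrix_vector_simps algebra_simps)
    then show ?thesis
      by (simp add: \<Gamma>_def matrix_vector_simps)
  qed
  then have "r = matrix_inv \<Gamma> *v (V *v (F *v q + Fu *v c - w) + v)"
    using matrix_inv_cancel(2)[OF \<Gamma>, of r] by simp
  then have r_eq: "r = M *v (F *v q + Fu *v c) + matrix_inv \<Gamma> *v (v - V *v w)"
    by (simp add: M_def matrix_vector_simps)
  have "Z *v c + Y *v q + d = 0"
    using control unfolding r_eq
    by (simp add: Z_def Y_def d_def M_def matrix_vector_simps algebra_simps)
  then have "Z *v c = - (Y *v q + d)"
    by (simp add: add_eq_0_iff algebra_simps)
  then have c: "c = - (matrix_inv Z *v (Y *v q + d))"
    using matrix_inv_cancel(2)[OF Z, of c] by (simp add: matrix_vector_simps)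
  have "l + L *v q + N *v c + transpose F *v r
      = l + L *v q + transpose F *v (M *v (F *v q))
        + transpose F *v (matrix_inv \<Gamma> *v (v - V *v w)) + transpose Y *v c"
    unfolding r_eq by (simp add: Y_eq matrix_vector_simps algebra_simps)
  also have "\<dots> = V' *v q + v'"
    unfolding c by (simp add: V'_def v'_def M_def matrix_vector_simps algebra_simps)
  finally show "l + L *v q + N *v c + transpose F *v r = V' *v q + v'" .
qed

section \<open>Second derivatives\<close>

text \<open>Weaker than \<open>C2\<close>: \<open>f1\<close> is differentiated only pointwise in the direction \<open>e\<close>, which avoids
  operator-valued derivatives and is stable under slicing. In \<open>f2 x q e\<close> the direction \<open>e\<close> comes
  from the first derivative and \<open>q\<close> from the second.\<close>

definition twice_diff ::
  "('a::real_normed_vector \<Rightarrow> 'b::real_normed_vector) \<Rightarrow> ('a \<Rightarrow> 'a \<Rightarrow> 'b) \<Rightarrow> ('a \<Rightarrow> 'a \<Rightarrow> 'a \<Rightarrow> 'b) \<Rightarrow> bool"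
  where "twice_diff \<phi> f1 f2 \<longleftrightarrow> (\<forall>x. (\<phi> has_derivative f1 x) (at x)) \<and>
    (\<forall>x e. ((\<lambda>y. f1 y e) has_derivative (\<lambda>q. f2 x q e)) (at x))"

lemma C2_twice_diff:
  assumes "C2 \<phi>"
  obtains f1 f2 where "twice_diff \<phi> f1 f2"
proof -
  obtain f' f'' where 1: "\<And>x. (\<phi> has_derivative blinfun_apply (f' x)) (at x)"
    and 2: "\<And>x. (f' has_derivative blinfun_apply (f'' x)) (at x)"
    using assms unfolding C2_def by blast
  have "((\<lambda>y. blinfun_apply (f' y) e) has_derivative (\<lambda>q. blinfun_apply (blinfun_apply (f'' x) q) e)) (at x)"
    for x e
    by (rule bounded_linear.has_derivative[OF blinfun.bounded_linear_left 2])
  with 1 have "twice_diff \<phi> (\<lambda>x. blinfun_apply (f' x)) (\<lambda>x q. blinfun_apply (blinfun_apply (f'' x) q))"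
    unfolding twice_diff_def by blast
  then show thesis ..
qed

text \<open>The second difference is symmetric in \<open>e\<close> and \<open>q\<close>, so this bound yields Schwarz's theorem.\<close>

lemma second_difference_bound:
  fixes \<phi> :: "'a::real_normed_vector \<Rightarrow> 'b::real_normed_vector"
  assumes d1: "\<And>x. (\<phi> has_derivative f1 x) (at x)"
    and d2: "((\<lambda>y. f1 y e) has_derivative f2) (at x)" and "\<epsilon> > 0"
  shows "\<forall>\<^sub>F t in at_right 0. norm (\<phi> (x + t *\<^sub>R e + t *\<^sub>R q) - \<phi> (x + t *\<^sub>R e)
      - \<phi> (x + t *\<^sub>R q) + \<phi> x - t\<^sup>2 *\<^sub>R f2 q) \<le> \<epsilon> * t\<^sup>2"
proof -
  \<comment> \<open>Both points at which \<open>f1\<close> is evaluated below lie within t M of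
    \<open>x\<close>; the added 1 keeps \<open>M\<close> positive when \<open>e\<close> and
    \<open>q\<close> vanish.\<close>
  define M where "M = norm e + norm q + 1"
  have M: "M > 0" unfolding M_def by (simp add: add_nonneg_pos)
  interpret f2: bounded_linear f2
    using d2 by (rule has_derivative_bounded_linear)
  \<comment> \<open>Two linearisation errors of size \<epsilon>' t M, times an outer factor t, add
    up to \<epsilon> t^2.\<close>
  define \<epsilon>' where "\<epsilon>' = \<epsilon> / (2 * M)"
  have "\<epsilon>' > 0" using M \<open>\<epsilon> > 0\<close> by (simp add: \<epsilon>'_def)
  with d2 obtain \<delta> where \<delta>: "\<delta> > 0"
    and bnd: "\<And>y. norm (y - x) < \<delta> \<Longrightarrow> norm (f1 y e - f1 x e - f2 (y - x)) \<le> \<epsilon>' * norm (y - x)"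
    unfolding has_derivative_at_alt by blast
  have small: "norm (\<phi> (x + t *\<^sub>R e + t *\<^sub>R q) - \<phi> (x + t *\<^sub>R e)
      - \<phi> (x + t *\<^sub>R q) + \<phi> x - t\<^sup>2 *\<^sub>R f2 q) \<le> \<epsilon> * t\<^sup>2" if t: "0 < t" "t < \<delta> / M" for t
  proof -
    have tM: "t * M < \<delta>" using t M by (simp add: field_simps)
    \<comment> \<open>The second difference is \<psi> 1 - \<psi> 0. The derivative of \<psi> is t
      times a difference of two values of \<open>f1\<close>, and each value is compared with its
      linearisation at \<open>x\<close>.\<close>
    define \<psi> where "\<psi> s = \<phi> (x + (s * t) *\<^sub>R e + t *\<^sub>R q) - \<phi> (x + (s * t) *\<^sub>R e)" for s
    define \<psi>' where "\<psi>' s = t *\<^sub>R (f1 (x + (s * t) *\<^sub>R e + t *\<^sub>R q) e - f1 (x + (s * t) *\<^sub>R e) e)" for s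
    have lin: "f1 y (c *\<^sub>R e) = c *\<^sub>R f1 y e" for y c
      using d1[of y] has_derivative_bounded_linear bounded_linear.linear linear_scale by blast
    have deriv: "(\<psi> has_derivative (\<lambda>h. h *\<^sub>R \<psi>' s)) (at s within {0..1})" for s
      unfolding \<psi>_def
      by (rule has_derivative_eq_rhs,
          (rule derivative_eq_intros has_derivative_compose[OF _ d1] refl)+)
        (auto simp: \<psi>'_def lin fun_eq_iff algebra_simps)
    have step: "norm (\<psi>' s - t\<^sup>2 *\<^sub>R f2 q) \<le> \<epsilon> * t\<^sup>2" if s: "s \<in> {0..1}" for s
    proof -
      define a where "a = (s * t) *\<^sub>R e + t *\<^sub>R q"
      define b where "b = (s * t) *\<^sub>R e"
      have st: "s * t \<le> t" "0 \<le> s * t"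
        using s t by (auto intro: mult_left_le_one_le)
      have b: "norm b \<le> t * M"
      proof -
        have "norm b \<le> t * norm e" using st by (simp add: b_def mult_right_mono del: mult_le_cancel_right)
        also have "\<dots> \<le> t * M" using t by (simp add: M_def)
        finally show ?thesis .
      qed
      have a: "norm a \<le> t * M"
      proof -
        have "norm a \<le> norm b + t * norm q"
          unfolding a_def b_def using t by (metis abs_of_pos norm_scaleR norm_triangle_ineq)
        also have "norm b \<le> t * norm e" using st by (simp add: b_def mult_right_mono del: mult_le_cancel_right)
        finally show ?thesis using t by (simp add: M_def algebra_simps)
      qed
      have "norm (f1 (x + a) e - f1 x e - f2 a) \<le> \<epsilon>' * (t * M)"
        using bnd[of "x + a"] a tM \<open>\<epsilon>' > 0\<close> by (smt (verit) add_diff_cancel_left' mult_left_mono)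
      moreover have "norm (f1 (x + b) e - f1 x e - f2 b) \<le> \<epsilon>' * (t * M)"
        using bnd[of "x + b"] b tM \<open>\<epsilon>' > 0\<close> by (smt (verit) add_diff_cancel_left' mult_left_mono)
      ultimately have "norm ((f1 (x + a) e - f1 x e - f2 a) - (f1 (x + b) e - f1 x e - f2 b))
          \<le> 2 * (\<epsilon>' * (t * M))"
        using norm_triangle_ineq4 by (smt (verit))
      moreover have "\<psi>' s - t\<^sup>2 *\<^sub>R f2 q
          = t *\<^sub>R ((f1 (x + a) e - f1 x e - f2 a) - (f1 (x + b) e - f1 x e - f2 b))"
        by (simp add: \<psi>'_def a_def b_def f2.add f2.scaleR algebra_simps power2_eq_square)
      ultimately have "norm (\<psi>' s - t\<^sup>2 *\<^sub>R f2 q) \<le> t * (2 * (\<epsilon>' * (t * M)))"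
        using t by simp
      also have "\<dots> = \<epsilon> * t\<^sup>2"
        using M by (simp add: \<epsilon>'_def power2_eq_square)
      finally show ?thesis .
    qed
    \<comment> \<open>Mean value inequality, applied after subtracting the linear function s t^2
      f2(q), so that the bound on the derivative is the error bound \<open>step\<close>.\<close>
    have "norm ((\<psi> 1 - 1 *\<^sub>R t\<^sup>2 *\<^sub>R f2 q) - (\<psi> 0 - 0 *\<^sub>R t\<^sup>2 *\<^sub>R f2 q)) \<le> \<epsilon> * t\<^sup>2 * norm (1 - 0 :: real)"
    proof (rule differentiable_bound)
      show "((\<lambda>s. \<psi> s - s *\<^sub>R t\<^sup>2 *\<^sub>R f2 q) has_derivative (\<lambda>h. h *\<^sub>R (\<psi>' s - t\<^sup>2 *\<^sub>R f2 q)))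
          (at s within {0..1})" for s
        by (rule has_derivative_eq_rhs, (rule derivative_eq_intros deriv refl)+)
          (auto simp: fun_eq_iff algebra_simps)
      show "onorm (\<lambda>h. h *\<^sub>R (\<psi>' s - t\<^sup>2 *\<^sub>R f2 q)) \<le> \<epsilon> * t\<^sup>2" if "s \<in> {0..1}" for s
        by (rule onorm_le) (use step[OF that] in \<open>simp add: mult.commute mult_left_mono\<close>)
    qed auto
    then show ?thesis
      by (simp add: \<psi>_def algebra_simps)
  qed
  show ?thesis
    unfolding eventually_at_right_field
    by (rule exI[of _ "\<delta> / M"]) (use \<delta> M small in simp)
qed

text \<open>For small t > 0 both values are within \<epsilon> of the same second difference divided
  by t^2, hence within 2 \<epsilon> of each other.\<close>

lemma twice_diff_symmetric:
  fixes \<phi> :: "'a::real_normed_vector \<Rightarrow> 'b::real_normed_vector"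
  assumes "twice_diff \<phi> f1 f2"
  shows "f2 x q e = f2 x e q"
proof -
  have "norm (f2 x q e - f2 x e q) \<le> 2 * \<epsilon>" if "\<epsilon> > 0" for \<epsilon>
  proof -
    have "\<forall>\<^sub>F t in at_right (0::real). norm (\<phi> (x + t *\<^sub>R e + t *\<^sub>R q) - \<phi> (x + t *\<^sub>R e)
        - \<phi> (x + t *\<^sub>R q) + \<phi> x - t\<^sup>2 *\<^sub>R f2 x q e) \<le> \<epsilon> * t\<^sup>2"
      using assms that unfolding twice_diff_def
      by (intro second_difference_bound[of \<phi> f1]) auto
    moreover have "\<forall>\<^sub>F t in at_right (0::real). norm (\<phi> (x + t *\<^sub>R q + t *\<^sub>R e) - \<phi> (x + t *\<^sub>R q)
        - \<phi> (x + t *\<^sub>R e) + \<phi> x - t\<^sup>2 *\<^sub>R f2 x e q) \<le> \<epsilon> * t\<^sup>2"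
      using assms that unfolding twice_diff_def
      by (intro second_difference_bound[of \<phi> f1]) auto
    moreover have "\<forall>\<^sub>F t in at_right (0::real). 0 < t"
      by (simp add: eventually_at_right_less)
    ultimately have "\<forall>\<^sub>F t in at_right (0::real). norm (f2 x q e - f2 x e q) \<le> 2 * \<epsilon>"
    proof eventually_elim
      case (elim t)
      let ?\<Delta> = "\<phi> (x + t *\<^sub>R e + t *\<^sub>R q) - \<phi> (x + t *\<^sub>R e) - \<phi> (x + t *\<^sub>R q) + \<phi> x"
      have "norm (?\<Delta> - t\<^sup>2 *\<^sub>R f2 x e q) \<le> \<epsilon> * t\<^sup>2"
        using elim(2) by (simp add: algebra_simps)
      with elim(1) have "norm ((?\<Delta> - t\<^sup>2 *\<^sub>R f2 x e q) - (?\<Delta> - t\<^sup>2 *\<^sub>R f2 x q e)) \<le> 2 * (\<epsilon> * t\<^sup>2)"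
        using norm_triangle_ineq4 by (smt (verit))
      also have "(?\<Delta> - t\<^sup>2 *\<^sub>R f2 x e q) - (?\<Delta> - t\<^sup>2 *\<^sub>R f2 x q e) = t\<^sup>2 *\<^sub>R (f2 x q e - f2 x e q)"
        by (simp add: algebra_simps)
      finally show ?case
        using elim(3) by simp
    qed
    \<comment> \<open>The inequality does not mention t, and the filter of right neighbourhoods of 0
      is nontrivial.\<close>
    then show ?thesis
      by (simp add: eventually_const_iff)
  qed
  then have "norm (f2 x q e - f2 x e q) \<le> 0 + \<epsilon>" if "\<epsilon> > 0" for \<epsilon>
    using that by (metis add_0 field_sum_of_halves half_gt_zero mult_2)
  then have "norm (f2 x q e - f2 x e q) \<le> 0"
    by (rule field_le_epsilon)
  then show ?thesis by simp
qed

text \<open>Linearity in the last argument of \<open>f2\<close> is not part of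
  \<open>twice_diff\<close>; symmetry moves that argument to the slot of the second derivative,
  where linearity is known.\<close>

lemma twice_diff_linear:
  assumes "twice_diff \<phi> f1 f2"
  shows "linear (f1 x)" and "linear (\<lambda>q. f2 x q e)" and "linear (f2 x q)"
proof -
  show 1: "linear (f1 x)" "linear (\<lambda>q. f2 x q e)" for e
    using assms has_derivative_linear unfolding twice_diff_def by blast+
  show "linear (f2 x q)"
    using 1(2)[of q] twice_diff_symmetric[OF assms, of x q] by presburger
qed

lemma twice_diff_bounded_linear:
  assumes "twice_diff \<phi> f1 f2" and "bounded_linear b"
  shows "twice_diff (\<lambda>x. b (\<phi> x)) (\<lambda>x e. b (f1 x e)) (\<lambda>x q e. b (f2 x q e))"
  using assms by (auto simp: twice_diff_def intro: bounded_linear.has_derivative)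

lemma twice_diff_slice1:
  assumes "twice_diff (\<lambda>(x, u). \<phi> x u) f1 f2"
  shows "twice_diff (\<lambda>x. \<phi> x u) (\<lambda>x e. f1 (x, u) (e, 0)) (\<lambda>x q e. f2 (x, u) (q, 0) (e, 0))"
proof -
  have emb: "((\<lambda>x. (x, u)) has_derivative (\<lambda>e. (e, 0))) (at x)" for x
    by (auto intro!: derivative_eq_intros)
  show ?thesis
    using assms has_derivative_compose[OF emb] unfolding twice_diff_def by fastforce
qed

lemma twice_diff_slice2:
  assumes "twice_diff (\<lambda>(x, u). \<phi> x u) f1 f2"
  shows "twice_diff (\<phi> x) (\<lambda>u e. f1 (x, u) (0, e)) (\<lambda>u q e. f2 (x, u) (0, q) (0, e))"
proof -
  have emb: "((\<lambda>u. (x, u)) has_derivative (\<lambda>e. (0, e))) (at u)" for u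
    by (auto intro!: derivative_eq_intros)
  show ?thesis
    using assms has_derivative_compose[OF emb] unfolding twice_diff_def by fastforce
qed

section \<open>Jacobians, gradients and Hessian blocks as linear and bilinear forms\<close>

lemma jacobian_mult:
  fixes f :: "real^'n \<Rightarrow> real^'m"
  assumes "(f has_derivative f') (at x)"
  shows "jacobian f (at x) *v e = f' e"
  using assms frechet_derivative_at[OF assms]
  by (metis has_derivative_linear jacobian_def matrix_works linear_matrix_vector_mul_eq)

lemma inner_axis_values:
  fixes f :: "real^'n \<Rightarrow> real"
  assumes "linear f"
  shows "e \<bullet> (\<chi> i. f (axis i 1)) = f e"
proof -
  have "e = (\<Sum>i\<in>UNIV. e $ i *\<^sub>R axis i 1)"
    by (simp add: vec_eq_iff axis_def if_distrib cong: if_cong)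
  then have "f e = (\<Sum>i\<in>UNIV. e $ i * f (axis i 1))"
    using assms by (metis (mono_tags, lifting) linear_scale linear_sum real_scaleR_def sum.cong)
  then show ?thesis
    by (simp add: inner_vec_def)
qed

lemma grad_eq:
  assumes "(\<phi> has_derivative f') (at x)"
  shows "grad \<phi> x = (\<chi> i. f' (axis i 1))"
  using frechet_derivative_at[OF assms] by (simp add: grad_def)

lemma inner_grad:
  assumes "(\<phi> has_derivative f') (at x)"
  shows "e \<bullet> grad \<phi> x = f' e"
  unfolding grad_eq[OF assms] by (rule inner_axis_values[OF has_derivative_linear[OF assms]])

lemma has_derivative_vec_lambda:
  fixes f :: "'a::euclidean_space \<Rightarrow> 'i::finite \<Rightarrow> real"
  assumes "\<And>i. ((\<lambda>x. f x i) has_derivative (\<lambda>h. f' h i)) (at x)"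
  shows "((\<lambda>x. \<chi> i. f x i) has_derivative (\<lambda>h. \<chi> i. f' h i)) (at x)"
  using assms
  by (subst has_derivative_componentwise_within) (auto simp: Basis_vec_def inner_axis)

text \<open>The gradient lists the values of \<open>f1 y\<close> on the axes. Differentiating it
  componentwise in the parameter \<open>y\<close> and pairing with \<open>e\<close> reassembles
  \<open>f2 q e\<close> by linearity. The base point \<open>x\<close> stays fixed, which is the
  situation of a mixed block.\<close>

lemma inner_jacobian_grad:
  fixes g :: "real^'m \<Rightarrow> real^'n \<Rightarrow> real"
  assumes "\<And>y. (g y has_derivative f1 y) (at x)"
    and "\<And>e. ((\<lambda>y. f1 y e) has_derivative (\<lambda>q. f2 q e)) (at y)"
    and "\<And>q. linear (f2 q)"
  shows "e \<bullet> (jacobian (\<lambda>y. grad (g y) x) (at y) *v q) = f2 q e"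
proof -
  have "((\<lambda>y. grad (g y) x) has_derivative (\<lambda>q. \<chi> i. f2 q (axis i 1))) (at y)"
    unfolding grad_eq[OF assms(1)] by (intro has_derivative_vec_lambda assms(2))
  then show ?thesis
    by (simp add: jacobian_mult inner_axis_values assms(3))
qed

lemma inner_hess:
  assumes "twice_diff \<phi> f1 f2"
  shows "e \<bullet> (hess \<phi> x *v q) = f2 x q e"
proof -
  have "(grad \<phi> has_derivative (\<lambda>q. \<chi> i. f2 x q (axis i 1))) (at x)"
  proof -
    have "grad \<phi> = (\<lambda>y. \<chi> i. f1 y (axis i 1))"
      using assms grad_eq unfolding twice_diff_def by blast
    then show ?thesis
      using assms by (auto simp: twice_diff_def intro!: has_derivative_vec_lambda)
  qed
  then show ?thesis
    by (simp add: hess_def jacobian_mult inner_axis_values twice_diff_linear[OF assms])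
qed

lemma inner_hess_xu:
  assumes "twice_diff (\<lambda>(x, u). \<phi> x u) f1 f2"
  shows "e \<bullet> (hess_xu \<phi> x u *v v) = f2 (x, u) (0, v) (e, 0)"
  unfolding hess_xu_def
proof (rule inner_jacobian_grad)
  show "((\<lambda>\<xi>. \<phi> \<xi> y) has_derivative (\<lambda>e. f1 (x, y) (e, 0))) (at x)" for y
    using twice_diff_slice1[OF assms] unfolding twice_diff_def by blast
  show "((\<lambda>y. f1 (x, y) (e, 0)) has_derivative (\<lambda>v. f2 (x, u) (0, v) (e, 0))) (at u)" for e
  proof -
    have "((\<lambda>u. (x, u)) has_derivative (\<lambda>v. (0, v))) (at u)"
      by (auto intro!: derivative_eq_intros)
    then show ?thesis
      using assms has_derivative_compose unfolding twice_diff_def by fast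
  qed
  have "linear (\<lambda>e::real^'a. (e, 0::real^'b))"
    by (auto intro!: linearI)
  then show "linear (\<lambda>e. f2 (x, u) (0, v) (e, 0))" for v
    using linear_compose twice_diff_linear(3)[OF assms] unfolding comp_def by blast
qed

lemma transpose_eq_selfI:
  fixes A :: "real^'n^'n"
  assumes "\<And>e q. e \<bullet> (A *v q) = q \<bullet> (A *v e)"
  shows "transpose A = A"
proof -
  have "e \<bullet> (transpose A *v q) = e \<bullet> (A *v q)" for e q
    using assms[of q e] by (metis dot_lmul_matrix inner_commute transpose_matrix_vector)
  then show ?thesis
    unfolding matrix_eq by (metis inner_commute vector_eq_ldot)
qed

lemma transpose_hess:
  assumes "twice_diff \<phi> f1 f2"
  shows "transpose (hess \<phi> x) = hess \<phi> x"
  by (rule transpose_eq_selfI) (simp add: inner_hess[OF assms] twice_diff_symmetric[OF assms, of x])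

lemma sum_scaleR_matrix_vector_mult:
  fixes A :: "'i \<Rightarrow> real^'n^'m"
  shows "(\<Sum>i\<in>I. c i *\<^sub>R A i) *v x = (\<Sum>i\<in>I. c i *\<^sub>R (A i *v x))"
  by (induction I rule: infinite_finite_induct)
    (simp_all add: matrix_vector_mult_add_rdistrib flip: scaleR_matrix_vector_assoc)

lemma inner_whess:
  assumes "twice_diff \<phi> f1 f2"
  shows "e \<bullet> (whess a \<phi> x *v q) = a \<bullet> f2 x q e"
proof -
  have "twice_diff (\<lambda>\<xi>. \<phi> \<xi> $ m) (\<lambda>x e. f1 x e $ m) (\<lambda>x q e. f2 x q e $ m)" for m
    using twice_diff_bounded_linear[OF assms bounded_linear_vec_nth] .
  from inner_hess[OF this] show ?thesis
    by (simp add: whess_def sum_scaleR_matrix_vector_mult inner_sum_right inner_vec_def[of a])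
qed

lemma inner_whess_xu:
  assumes "twice_diff (\<lambda>(x, u). \<phi> x u) f1 f2"
  shows "e \<bullet> (whess_xu a \<phi> x u *v v) = a \<bullet> f2 (x, u) (0, v) (e, 0)"
proof -
  have "twice_diff (\<lambda>(x, u). \<phi> x u $ m) (\<lambda>x e. f1 x e $ m) (\<lambda>x q e. f2 x q e $ m)" for m
    using twice_diff_bounded_linear[OF assms bounded_linear_vec_nth]
    by (simp add: case_prod_unfold)
  from inner_hess_xu[OF this] show ?thesis
    by (simp add: whess_xu_def sum_scaleR_matrix_vector_mult inner_sum_right inner_vec_def[of a])
qed

lemma transpose_whess:
  assumes "twice_diff \<phi> f1 f2"
  shows "transpose (whess a \<phi> x) = whess a \<phi> x"
  by (rule transpose_eq_selfI) (simp add: inner_whess[OF assms] twice_diff_symmetric[OF assms, of x])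

text \<open>Bilinear expansion over the two factors. One mixed term is reordered by symmetry, so
  that a single block, the one of \<open>hess_xu\<close>, represents both.\<close>

lemma twice_diff_split:
  assumes "twice_diff \<Phi> f1 f2"
  shows "f1 x (e, w) = f1 x (e, 0) + f1 x (0, w)"
    and "f2 x (q, v) (e, w)
      = f2 x (q, 0) (e, 0) + f2 x (0, v) (e, 0) + f2 x (0, w) (q, 0) + f2 x (0, v) (0, w)"
proof -
  note lin = twice_diff_linear[OF assms, THEN linear_add]
  show "f1 x (e, w) = f1 x (e, 0) + f1 x (0, w)"
    using lin(1)[of x "(e, 0)" "(0, w)"] by simp
  have "f2 x (q, v) (e, w) = f2 x (q, v) (e, 0) + f2 x (q, v) (0, w)"
    using lin(3)[of x "(q, v)" "(e, 0)" "(0, w)"] by simp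
  also have "f2 x (q, v) (e, 0) = f2 x (q, 0) (e, 0) + f2 x (0, v) (e, 0)"
    using lin(2)[of x "(q, 0)" "(0, v)" "(e, 0)"] by simp
  also have "f2 x (q, v) (0, w) = f2 x (q, 0) (0, w) + f2 x (0, v) (0, w)"
    using lin(2)[of x "(q, 0)" "(0, v)" "(0, w)"] by simp
  also have "f2 x (q, 0) (0, w) = f2 x (0, w) (q, 0)"
    by (rule twice_diff_symmetric[OF assms])
  finally show "f2 x (q, v) (e, w)
      = f2 x (q, 0) (e, 0) + f2 x (0, v) (e, 0) + f2 x (0, w) (q, 0) + f2 x (0, v) (0, w)"
    by simp
qed

lemma scalar_pair_expansion:
  fixes \<phi> :: "real^'n \<Rightarrow> real^'m \<Rightarrow> real"
  assumes "twice_diff (\<lambda>(x, u). \<phi> x u) f1 f2"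
  shows "f1 (x, u) (e, w) = e \<bullet> grad (\<lambda>\<xi>. \<phi> \<xi> u) x + w \<bullet> grad (\<phi> x) u"
    and "f2 (x, u) (q, v) (e, w) = e \<bullet> (hess (\<lambda>\<xi>. \<phi> \<xi> u) x *v q) + e \<bullet> (hess_xu \<phi> x u *v v)
      + q \<bullet> (hess_xu \<phi> x u *v w) + w \<bullet> (hess (\<phi> x) u *v v)"
proof -
  note slices = twice_diff_slice1[OF assms, of u] twice_diff_slice2[OF assms, of x]
  have "((\<lambda>\<xi>. \<phi> \<xi> u) has_derivative (\<lambda>e. f1 (x, u) (e, 0))) (at x)"
    and "(\<phi> x has_derivative (\<lambda>e. f1 (x, u) (0, e))) (at u)"
    using slices unfolding twice_diff_def by blast+
  then show "f1 (x, u) (e, w) = e \<bullet> grad (\<lambda>\<xi>. \<phi> \<xi> u) x + w \<bullet> grad (\<phi> x) u"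
    by (simp add: inner_grad twice_diff_split(1)[OF assms, of "(x, u)" e w])
  show "f2 (x, u) (q, v) (e, w) = e \<bullet> (hess (\<lambda>\<xi>. \<phi> \<xi> u) x *v q) + e \<bullet> (hess_xu \<phi> x u *v v)
      + q \<bullet> (hess_xu \<phi> x u *v w) + w \<bullet> (hess (\<phi> x) u *v v)"
    by (simp add: inner_hess[OF slices(1)] inner_hess[OF slices(2)] inner_hess_xu[OF assms]
        twice_diff_split(2)[OF assms, of "(x, u)" q v e w])
qed

lemma vector_pair_expansion:
  fixes \<phi> :: "real^'n \<Rightarrow> real^'m \<Rightarrow> real^'k"
  assumes "twice_diff (\<lambda>(x, u). \<phi> x u) f1 f2"
  shows "f1 (x, u) (e, w)
      = jacobian (\<lambda>\<xi>. \<phi> \<xi> u) (at x) *v e + jacobian (\<phi> x) (at u) *v w"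
    and "a \<bullet> f2 (x, u) (q, v) (e, w) = e \<bullet> (whess a (\<lambda>\<xi>. \<phi> \<xi> u) x *v q)
      + e \<bullet> (whess_xu a \<phi> x u *v v) + q \<bullet> (whess_xu a \<phi> x u *v w) + w \<bullet> (whess a (\<phi> x) u *v v)"
proof -
  note slices = twice_diff_slice1[OF assms, of u] twice_diff_slice2[OF assms, of x]
  have "((\<lambda>\<xi>. \<phi> \<xi> u) has_derivative (\<lambda>e. f1 (x, u) (e, 0))) (at x)"
    and "(\<phi> x has_derivative (\<lambda>e. f1 (x, u) (0, e))) (at u)"
    using slices unfolding twice_diff_def by blast+
  then show "f1 (x, u) (e, w)
      = jacobian (\<lambda>\<xi>. \<phi> \<xi> u) (at x) *v e + jacobian (\<phi> x) (at u) *v w"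
    by (simp add: jacobian_mult twice_diff_split(1)[OF assms, of "(x, u)" e w])
  show "a \<bullet> f2 (x, u) (q, v) (e, w) = e \<bullet> (whess a (\<lambda>\<xi>. \<phi> \<xi> u) x *v q)
      + e \<bullet> (whess_xu a \<phi> x u *v v) + q \<bullet> (whess_xu a \<phi> x u *v w) + w \<bullet> (whess a (\<phi> x) u *v v)"
    by (simp add: inner_whess[OF slices(1)] inner_whess[OF slices(2)] inner_whess_xu[OF assms]
        twice_diff_split(2)[OF assms, of "(x, u)" q v e w] inner_add_right)
qed

section \<open>Derivatives along the decision variables\<close>

definition unit_point :: "('x, 'u) coord \<Rightarrow> ('x, 'u) point" where
  "unit_point c = (\<lambda>d. if d = c then 1 else 0)"

text \<open>Points form an infinite product without a norm, so a derivative is a functional \<open>\<Lambda>\<close> that gives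
  the partial derivatives on unit points and depends linearly on the decision coordinates alone.\<close>

definition point_deriv :: "('x::finite, 'u::finite, 'y::finite) problem \<Rightarrow>
    (('x, 'u) point \<Rightarrow> 'b::real_normed_vector) \<Rightarrow> (('x, 'u) point \<Rightarrow> 'b) \<Rightarrow> ('x, 'u) point \<Rightarrow> bool" where
  "point_deriv D g \<Lambda> z \<longleftrightarrow>
    (\<forall>d. ((\<lambda>s. g (z(d := s))) has_vector_derivative \<Lambda> (unit_point d)) (at (z d))) \<and>
    (\<forall>p. \<Lambda> p = (\<Sum>d\<in>decision D. p d *\<^sub>R \<Lambda> (unit_point d)))"

lemma point_derivD:
  assumes "point_deriv D g \<Lambda> z"
  shows "((\<lambda>s. g (z(d := s))) has_vector_derivative \<Lambda> (unit_point d)) (at (z d))"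
    and "(\<Sum>d\<in>decision D. p d *\<^sub>R \<Lambda> (unit_point d)) = \<Lambda> p"
  using assms unfolding point_deriv_def by metis+

section \<open>Rules for first and second derivatives on points\<close>

lemma point_deriv_compose:
  assumes g: "point_deriv D g \<Lambda> z" and F: "(F has_derivative F') (at (g z))"
  shows "point_deriv D (\<lambda>z. F (g z)) (\<lambda>q. F' (\<Lambda> q)) z"
  unfolding point_deriv_def
proof (intro conjI allI)
  have lin: "linear F'" using F by (rule has_derivative_linear)
  show "((\<lambda>s. F (g (z(d := s)))) has_vector_derivative F' (\<Lambda> (unit_point d))) (at (z d))" for d
  proof -
    have "((\<lambda>s. g (z(d := s))) has_derivative (\<lambda>h. h *\<^sub>R \<Lambda> (unit_point d))) (at (z d))"
      using g unfolding point_deriv_def has_vector_derivative_def by blast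
    from has_derivative_compose[OF this, of F F'] F
    have "((\<lambda>s. F (g (z(d := s)))) has_derivative (\<lambda>h. F' (h *\<^sub>R \<Lambda> (unit_point d)))) (at (z d))"
      by simp
    then show ?thesis
      by (simp add: has_vector_derivative_def linear_scale[OF lin])
  qed
  show "F' (\<Lambda> p) = (\<Sum>d\<in>decision D. p d *\<^sub>R F' (\<Lambda> (unit_point d)))" for p
  proof -
    have "F' (\<Lambda> p) = F' (\<Sum>d\<in>decision D. p d *\<^sub>R \<Lambda> (unit_point d))"
      using point_derivD(2)[OF g, of p] by simp
    then show ?thesis
      by (simp add: linear_sum[OF lin] linear_scale[OF lin])
  qed
qed

lemma point_deriv_Pair:
  assumes "point_deriv D f \<Lambda> z" and "point_deriv D g \<Omega> z"
  shows "point_deriv D (\<lambda>z. (f z, g z)) (\<lambda>q. (\<Lambda> q, \<Omega> q)) z"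
  unfolding point_deriv_def
  by (simp add: prod_eq_iff fst_sum snd_sum has_vector_derivative_Pair point_derivD[OF assms(1)]
      point_derivD[OF assms(2)])

lemma point_deriv_const: "point_deriv D (\<lambda>z. c) (\<lambda>q. 0) z"
  by (simp add: point_deriv_def)

lemma point_deriv_add:
  assumes "point_deriv D f \<Lambda> z" and "point_deriv D g \<Omega> z"
  shows "point_deriv D (\<lambda>z. f z + g z) (\<lambda>q. \<Lambda> q + \<Omega> q) z"
proof -
  have "((\<lambda>p. fst p + snd p) has_derivative (\<lambda>p. fst p + snd p)) (at (f z, g z))"
    by (auto intro!: derivative_eq_intros)
  from point_deriv_compose[OF point_deriv_Pair[OF assms] this] show ?thesis by simp
qed

lemma point_deriv_bounded_linear:
  assumes "point_deriv D f \<Lambda> z" and "bounded_linear b"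
  shows "point_deriv D (\<lambda>z. b (f z)) (\<lambda>q. b (\<Lambda> q)) z"
  using assms point_deriv_compose bounded_linear_imp_has_derivative by blast

lemma point_deriv_sum:
  assumes "\<And>i. i \<in> I \<Longrightarrow> point_deriv D (f i) (\<Lambda> i) z"
  shows "point_deriv D (\<lambda>z. \<Sum>i\<in>I. f i z) (\<lambda>q. \<Sum>i\<in>I. \<Lambda> i q) z"
  using assms
  by (induction I rule: infinite_finite_induct) (simp_all add: point_deriv_const point_deriv_add)

lemma point_deriv_inner:
  fixes f g :: "_ \<Rightarrow> 'b::real_inner"
  assumes "point_deriv D f \<Lambda> z" and "point_deriv D g \<Omega> z"
  shows "point_deriv D (\<lambda>z. f z \<bullet> g z) (\<lambda>q. f z \<bullet> \<Omega> q + \<Lambda> q \<bullet> g z) z"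
proof -
  have "((\<lambda>p. fst p \<bullet> snd p) has_derivative (\<lambda>p. f z \<bullet> snd p + fst p \<bullet> g z)) (at (f z, g z))"
    by (auto intro!: derivative_eq_intros)
  from point_deriv_compose[OF point_deriv_Pair[OF assms] this] show ?thesis by simp
qed

text \<open>The direction \<open>e\<close> is fixed before the second differentiation, as in
  \<open>twice_diff\<close>. Thus \<open>G z e\<close> is again a function of the point alone, and
  the first-order rules apply to it.\<close>

definition point_deriv2 where
  "point_deriv2 D g G H \<longleftrightarrow>
    (\<forall>z. point_deriv D g (G z) z) \<and> (\<forall>z e. point_deriv D (\<lambda>z. G z e) (\<lambda>q. H z q e) z)"

text \<open>\<open>Y\<close> does not depend on the point, because states and controls are affine in
  it. Hence the inner function contributes no second-order term.\<close>

lemma point_deriv2_compose: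
  assumes "twice_diff \<phi> f1 f2" and "\<And>z. point_deriv D X Y z"
  shows "point_deriv2 D (\<lambda>z. \<phi> (X z)) (\<lambda>z e. f1 (X z) (Y e)) (\<lambda>z q e. f2 (X z) (Y q) (Y e))"
  unfolding point_deriv2_def
proof (intro conjI allI)
  show "point_deriv D (\<lambda>z. \<phi> (X z)) (\<lambda>e. f1 (X z) (Y e)) z" for z
    using point_deriv_compose[OF assms(2), of \<phi> "f1 (X z)" z] assms(1) by (simp add: twice_diff_def)
  show "point_deriv D (\<lambda>z. f1 (X z) (Y e)) (\<lambda>q. f2 (X z) (Y q) (Y e)) z" for z e
    using point_deriv_compose[OF assms(2), of "\<lambda>x. f1 x (Y e)" "\<lambda>q. f2 (X z) q (Y e)" z] assms(1)
    by (simp add: twice_diff_def)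
qed

lemma point_deriv2_affine:
  assumes "\<And>z. point_deriv D X Y z"
  shows "point_deriv2 D X (\<lambda>z. Y) (\<lambda>z q e. 0)"
  using assms by (simp add: point_deriv2_def point_deriv_const)

lemma point_deriv2_add:
  assumes "point_deriv2 D f F F'" and "point_deriv2 D g G G'"
  shows "point_deriv2 D (\<lambda>z. f z + g z) (\<lambda>z e. F z e + G z e) (\<lambda>z q e. F' z q e + G' z q e)"
  using assms by (simp add: point_deriv2_def point_deriv_add)

lemma point_deriv2_bounded_linear:
  assumes "point_deriv2 D f F F'" and "bounded_linear b"
  shows "point_deriv2 D (\<lambda>z. b (f z)) (\<lambda>z e. b (F z e)) (\<lambda>z q e. b (F' z q e))"
  unfolding point_deriv2_def
proof (intro conjI allI)
  show "point_deriv D (\<lambda>z. b (f z)) (\<lambda>e. b (F z e)) z" for z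
    using assms by (simp add: point_deriv2_def point_deriv_bounded_linear)
  show "point_deriv D (\<lambda>z. b (F z e)) (\<lambda>q. b (F' z q e)) z" for z e
  proof -
    have "point_deriv D (\<lambda>z. F z e) (\<lambda>q. F' z q e) z"
      using assms(1) unfolding point_deriv2_def by blast
    from point_deriv_bounded_linear[OF this assms(2)] show ?thesis .
  qed
qed

lemma point_deriv2_cmult:
  fixes f :: "_ \<Rightarrow> real"
  assumes "point_deriv2 D f F F'"
  shows "point_deriv2 D (\<lambda>z. c * f z) (\<lambda>z e. c * F z e) (\<lambda>z q e. c * F' z q e)"
  using point_deriv2_bounded_linear[OF assms bounded_linear_mult_right] .

lemma point_deriv2_diff:
  assumes "point_deriv2 D f F F'" and "point_deriv2 D g G G'"
  shows "point_deriv2 D (\<lambda>z. f z - g z) (\<lambda>z e. F z e - G z e) (\<lambda>z q e. F' z q e - G' z q e)"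
  using point_deriv2_add[OF assms(1) point_deriv2_bounded_linear[OF assms(2)
        bounded_linear_minus[OF bounded_linear_ident]]] by simp

lemma point_deriv2_sum:
  assumes "\<And>i. i \<in> I \<Longrightarrow> point_deriv2 D (f i) (F i) (F' i)"
  shows "point_deriv2 D (\<lambda>z. \<Sum>i\<in>I. f i z) (\<lambda>z e. \<Sum>i\<in>I. F i z e) (\<lambda>z q e. \<Sum>i\<in>I. F' i z q e)"
  using assms by (simp add: point_deriv2_def point_deriv_sum)

text \<open>Symmetry of \<open>A\<close> merges the two halves of the product rule. The second
  derivative consists of a Gauss-Newton part and a curvature part; the weight A f(z) of the latter
  becomes the w^T Q^-1 and \<gamma>^T R^-1 of the barred blocks.\<close>

lemma point_deriv2_quadratic:
  fixes A :: "real^'n^'n"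
  assumes f: "point_deriv2 D f F F'" and A: "transpose A = A"
  shows "point_deriv2 D (\<lambda>z. f z \<bullet> (A *v f z)) (\<lambda>z e. 2 * (F z e \<bullet> (A *v f z)))
    (\<lambda>z q e. 2 * (F z e \<bullet> (A *v F z q) + (A *v f z) \<bullet> F' z q e))"
  unfolding point_deriv2_def
proof (intro conjI allI)
  have sym: "x \<bullet> (A *v y) = y \<bullet> (A *v x)" for x y
    using A by (metis dot_lmul_matrix inner_commute transpose_matrix_vector)
  have f1: "point_deriv D f (F z) z" and f2: "point_deriv D (\<lambda>z. F z e) (\<lambda>q. F' z q e) z" for z e
    using f unfolding point_deriv2_def by blast+
  have Af: "point_deriv D (\<lambda>z. A *v f z) (\<lambda>q. A *v F z q) z" for z
    using point_deriv_bounded_linear[OF f1 matrix_vector_mul_bounded_linear] .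
  show "point_deriv D (\<lambda>z. f z \<bullet> (A *v f z)) (\<lambda>e. 2 * (F z e \<bullet> (A *v f z))) z" for z
    using point_deriv_inner[OF f1 Af, of z] by (simp add: sym[of "f z"])
  have "point_deriv D (\<lambda>z. F z e \<bullet> (A *v f z))
      (\<lambda>q. F z e \<bullet> (A *v F z q) + (A *v f z) \<bullet> F' z q e) z" for z e
    using point_deriv_inner[OF f2 Af] by (simp add: inner_commute[of "A *v f z"])
  from point_deriv_bounded_linear[OF this bounded_linear_mult_right]
  show "point_deriv D (\<lambda>z. 2 * (F z e \<bullet> (A *v f z)))
      (\<lambda>q. 2 * (F z e \<bullet> (A *v F z q) + (A *v f z) \<bullet> F' z q e)) z" for z e .
qed

text \<open>The linear part of \<open>ct\<close>: past controls are constants.\<close>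

definition cst :: "('x::finite, 'u::finite, 'y::finite) problem \<Rightarrow> ('x, 'u) point \<Rightarrow> nat \<Rightarrow> real^'u" where
  "cst D q k = (if k < cur D then 0 else (\<chi> b. q (Control k b)))"

section \<open>State and control coordinates as functions of the point, and scalar Newton
  rows\<close>

lemma finite_decision: "finite (decision D)"
proof -
  have "decision D = case_prod State ` ({..hor D} \<times> UNIV)
      \<union> case_prod Control ` ({cur D..<hor D} \<times> UNIV)"
    by (auto simp: decision_def)
  then show ?thesis by simp
qed

lemma sum_unit_point:
  assumes "c \<in> decision D"
  shows "(\<Sum>d\<in>decision D. p d * unit_point d c) = p c"
  using assms finite_decision[of D]
  by (simp add: unit_point_def if_distrib cong: if_cong)

lemma point_deriv_st:
  assumes "k \<le> hor D"
  shows "point_deriv D (\<lambda>z. st z k) (\<lambda>q. st q k) z"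
  unfolding point_deriv_def
proof (intro conjI allI)
  show "((\<lambda>s. st (z(d := s)) k) has_vector_derivative st (unit_point d) k) (at (z d))" for d
  proof -
    have "st (z(d := s)) k = st z k + (s - z d) *\<^sub>R st (unit_point d) k" for s
      by (simp add: vec_eq_iff st_def unit_point_def)
    then show ?thesis
      by (auto intro!: derivative_eq_intros)
  qed
  show "st p k = (\<Sum>d\<in>decision D. p d *\<^sub>R st (unit_point d) k)" for p
  proof -
    have "State k a \<in> decision D" for a
      using assms by (simp add: decision_def)
    then show ?thesis
      by (simp add: vec_eq_iff st_def sum_unit_point)
  qed
qed

lemma point_deriv_ct:
  assumes "k < hor D"
  shows "point_deriv D (\<lambda>z. ct D z k) (\<lambda>q. cst D q k) z"
  unfolding point_deriv_def
proof (intro conjI allI)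
  show "((\<lambda>s. ct D (z(d := s)) k) has_vector_derivative cst D (unit_point d) k) (at (z d))" for d
  proof -
    have "ct D (z(d := s)) k = ct D z k + (s - z d) *\<^sub>R cst D (unit_point d) k" for s
      by (simp add: vec_eq_iff ct_def cst_def unit_point_def)
    then show ?thesis
      by (auto intro!: derivative_eq_intros)
  qed
  show "cst D p k = (\<Sum>d\<in>decision D. p d *\<^sub>R cst D (unit_point d) k)" for p
  proof -
    have "Control k b \<in> decision D" if "\<not> k < cur D" for b
      using assms that by (simp add: decision_def)
    then show ?thesis
      by (simp add: vec_eq_iff cst_def sum_unit_point)
  qed
qed

text \<open>Each \<open>hessJ\<close> entry is \<open>H\<close> on two unit points; the second
  clause of \<open>point_deriv\<close> collapses their sum weighted by \<open>p\<close> to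
  \<open>H\<close> in the direction \<open>p\<close>.\<close>

lemma newton_row_iff:
  assumes "point_deriv2 D (J D) G H"
  shows "newton_row D z p c \<longleftrightarrow> H z p (unit_point c) + G z (unit_point c) = 0"
proof -
  have 1: "point_deriv D (J D) (G z) z"
    and 2: "point_deriv D (\<lambda>z. G z e) (\<lambda>q. H z q e) z" for z e
    using assms unfolding point_deriv2_def by blast+
  \<comment> \<open>\<open>gradJ\<close> is differentiated once more, so this is needed at every
    point.\<close>
  have "gradJ D c z = G z (unit_point c)" for z
    using point_derivD(1)[OF 1] unfolding gradJ_def
    by (simp add: DERIV_imp_deriv has_real_derivative_iff_has_vector_derivative)
  then have gradJ: "gradJ D c = (\<lambda>z. G z (unit_point c))" by blast
  have "hessJ D c d z = H z (unit_point d) (unit_point c)" for d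
    using point_derivD(1)[OF 2] unfolding hessJ_def gradJ
    by (simp add: DERIV_imp_deriv has_real_derivative_iff_has_vector_derivative)
  then have "(\<Sum>d\<in>decision D. hessJ D c d z * p d) = H z p (unit_point c)"
    using point_derivD(2)[OF 2, of p z "unit_point c"] by (simp add: mult.commute)
  then show ?thesis
    by (auto simp: newton_row_def gradJ)
qed

lemma inner_transpose: "(A *v x) \<bullet> y = x \<bullet> (transpose A *v y)"
  for A :: "real^'n^'m"
  by (metis dot_lmul_matrix inner_commute transpose_matrix_vector)

lemma symmetric_vector_mult:
  fixes A :: "real^'n^'n"
  assumes "transpose A = A"
  shows "x v* A = A *v x"
  using assms by (metis transpose_matrix_vector)

lemma sym_pos_def_matrix_inv:
  assumes "sym_pos_def A"
  shows "transpose (matrix_inv A) = matrix_inv A"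
  using assms sym_pos_def_invertible symmetric_matrix_inv unfolding sym_pos_def_def by blast

lemma st_unit_State: "st (unit_point (State k a)) j = (if j = k then axis a 1 else 0)"
  by (simp add: st_def unit_point_def vec_eq_iff axis_def)

lemma cst_unit_State: "cst D (unit_point (State k a)) j = 0"
  by (simp add: cst_def unit_point_def vec_eq_iff)

lemma st_unit_Control: "st (unit_point (Control k b)) j = 0"
  by (simp add: st_def unit_point_def vec_eq_iff)

lemma cst_unit_Control:
  "cur D \<le> k \<Longrightarrow> cst D (unit_point (Control k b)) j = (if j = k then axis b 1 else 0)"
  by (simp add: cst_def unit_point_def vec_eq_iff axis_def)

section \<open>The rows of the Newton system\<close>

locale smooth_problem =
  fixes D :: "('x::finite, 'u::finite, 'y::finite) problem"
  assumes cur_le: "cur D \<le> hor D" and mu_pos: "mu D > 0"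
    and dyn_C2: "\<And>j. j < hor D \<Longrightarrow> C2 (\<lambda>(x, u). dyn D j x u)"
    and meas_C2: "\<And>j. 1 \<le> j \<Longrightarrow> j \<le> cur D \<Longrightarrow> C2 (meas D j)"
    and cost_C2: "\<And>j. j < hor D \<Longrightarrow> C2 (\<lambda>(x, u). cost D j x u)"
    and fcost_C2: "C2 (fcost D)"
    and Pcov: "sym_pos_def (Pcov D)"
    and Qcov: "\<And>j. 1 \<le> j \<Longrightarrow> j \<le> hor D \<Longrightarrow> sym_pos_def (Qcov D j)"
    and Rcov: "\<And>j. 1 \<le> j \<Longrightarrow> j \<le> cur D \<Longrightarrow> sym_pos_def (Rcov D j)"
begin

section \<open>Second derivatives of the terms of \<open>J\<close>\<close>

lemma point_deriv_st_ct:
  assumes "j < hor D"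
  shows "point_deriv D (\<lambda>z. (st z j, ct D z j)) (\<lambda>q. (st q j, cst D q j)) z"
  using assms by (intro point_deriv_Pair point_deriv_st point_deriv_ct) auto

definition cost_hess where
  "cost_hess z j q e = st e j \<bullet> (hess (\<lambda>x. cost D j x (ct D z j)) (st z j) *v st q j)
    + st e j \<bullet> (hess_xu (cost D j) (st z j) (ct D z j) *v cst D q j)
    + st q j \<bullet> (hess_xu (cost D j) (st z j) (ct D z j) *v cst D e j)
    + cst D e j \<bullet> (hess (\<lambda>u. cost D j (st z j) u) (ct D z j) *v cst D q j)"

lemma cost_deriv2:
  assumes "j < hor D"
  shows "point_deriv2 D (\<lambda>z. cost D j (st z j) (ct D z j))
    (\<lambda>z e. st e j \<bullet> lx D z j + cst D e j \<bullet> lu D z j)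
    (\<lambda>z q e. cost_hess z j q e)"
proof -
  obtain f1 f2 where f: "twice_diff (\<lambda>(x, u). cost D j x u) f1 f2"
    using C2_twice_diff[OF cost_C2[OF assms]] .
  show ?thesis
    using point_deriv2_compose[OF f point_deriv_st_ct[OF assms]]
    unfolding scalar_pair_expansion[OF f] by (simp add: lx_def lu_def cost_hess_def)
qed

lemma fcost_deriv2:
  "point_deriv2 D (\<lambda>z. fcost D (st z (hor D)))
    (\<lambda>z e. st e (hor D) \<bullet> grad (fcost D) (st z (hor D)))
    (\<lambda>z q e. st e (hor D) \<bullet> (hess (fcost D) (st z (hor D)) *v st q (hor D)))"
proof -
  obtain f1 f2 where f: "twice_diff (fcost D) f1 f2"
    using C2_twice_diff[OF fcost_C2] .
  have "f1 x e = e \<bullet> grad (fcost D) x" for x e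
    using f inner_grad unfolding twice_diff_def by metis
  then show ?thesis
    using point_deriv2_compose[OF f point_deriv_st[OF order_refl]]
    by (simp add: inner_hess[OF f])
qed

lemma prior_deriv2:
  "point_deriv2 D (\<lambda>z. (st z 0 - xprior D) \<bullet> (matrix_inv (Pcov D) *v (st z 0 - xprior D)))
    (\<lambda>z e. 2 * (st e 0 \<bullet> (matrix_inv (Pcov D) *v (st z 0 - xprior D))))
    (\<lambda>z q e. 2 * (st e 0 \<bullet> (matrix_inv (Pcov D) *v st q 0)))"
proof -
  have "point_deriv D (\<lambda>z. st z 0 - xprior D) (\<lambda>q. st q 0) z" for z
    using point_deriv_add[OF point_deriv_st[of 0 D z] point_deriv_const[of D "- xprior D" z]]
    by simp
  from point_deriv2_quadratic[OF point_deriv2_affine[OF this] sym_pos_def_matrix_inv[OF Pcov]]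
  show ?thesis by simp
qed

lemma innov_deriv2:
  assumes j: "1 \<le> j" "j \<le> cur D"
  shows "point_deriv2 D (\<lambda>z. innov D z j \<bullet> (matrix_inv (Rcov D j) *v innov D z j))
    (\<lambda>z e. 2 * (- (hx D z j *v st e j) \<bullet> (matrix_inv (Rcov D j) *v innov D z j)))
    (\<lambda>z q e. 2 * ((hx D z j *v st e j) \<bullet> (matrix_inv (Rcov D j) *v (hx D z j *v st q j))
      - st e j \<bullet> (whess (innov D z j v* matrix_inv (Rcov D j)) (meas D j) (st z j) *v st q j)))"
proof -
  obtain f1 f2 where f: "twice_diff (meas D j) f1 f2"
    using C2_twice_diff[OF meas_C2[OF j]] .
  have j': "j \<le> hor D" using j cur_le by simp
  have f1: "f1 (st z j) e = hx D z j *v e" for z e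
    using f jacobian_mult unfolding twice_diff_def hx_def by metis
  have "point_deriv2 D (\<lambda>z. innov D z j) (\<lambda>z e. 0 - hx D z j *v st e j)
      (\<lambda>z q e. 0 - f2 (st z j) (st q j) (st e j))"
    using point_deriv2_diff[OF point_deriv2_affine[OF point_deriv_const[of D "yobs D j"]]
        point_deriv2_compose[OF f point_deriv_st[OF j']]]
    unfolding innov_def f1 .
  from point_deriv2_quadratic[OF this sym_pos_def_matrix_inv[OF Rcov[OF j]]]
  show ?thesis
    by (simp add: symmetric_vector_mult[OF sym_pos_def_matrix_inv[OF Rcov[OF j]]]
        inner_whess[OF f] matrix_vector_mult_uminus)
qed

text \<open>The derivative of the residual with index j + 1 in the direction
  \<open>q\<close>.\<close>

definition dresid where
  "dresid z j q = st q (Suc j) - fx D z j *v st q j - fu D z j *v cst D q j"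

text \<open>The row vector w^T Q^-1 paired with the second derivative of the dynamics in the
  directions \<open>q\<close> and \<open>e\<close>, written in blocks; times \<mu>^-1 it is the
  dynamics part of the barred blocks.\<close>

definition dyn_curv where
  "dyn_curv z j q e =
    st e j \<bullet> (whess (wQ D z (Suc j)) (\<lambda>x. dyn D j x (ct D z j)) (st z j) *v st q j)
    + st e j \<bullet> (whess_xu (wQ D z (Suc j)) (dyn D j) (st z j) (ct D z j) *v cst D q j)
    + st q j \<bullet> (whess_xu (wQ D z (Suc j)) (dyn D j) (st z j) (ct D z j) *v cst D e j)
    + cst D e j \<bullet> (whess (wQ D z (Suc j)) (\<lambda>u. dyn D j (st z j) u) (ct D z j) *v cst D q j)"

lemma resid_deriv2:
  assumes j: "j < hor D"
  shows "point_deriv2 D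
    (\<lambda>z. resid D z (Suc j) \<bullet> (matrix_inv (Qcov D (Suc j)) *v resid D z (Suc j)))
    (\<lambda>z e. 2 * (dresid z j e \<bullet> (matrix_inv (Qcov D (Suc j)) *v resid D z (Suc j))))
    (\<lambda>z q e. 2 * (dresid z j e \<bullet> (matrix_inv (Qcov D (Suc j)) *v dresid z j q)
      - dyn_curv z j q e))"
proof -
  obtain f1 f2 where f: "twice_diff (\<lambda>(x, u). dyn D j x u) f1 f2"
    using C2_twice_diff[OF dyn_C2[OF j]] .
  have Suc_j: "Suc j \<le> hor D" "1 \<le> Suc j" using j by simp_all
  note sym = sym_pos_def_matrix_inv[OF Qcov[OF Suc_j(2,1)]]
  have "point_deriv2 D (\<lambda>z. resid D z (Suc j)) (\<lambda>z e. dresid z j e)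
      (\<lambda>z q e. 0 - f2 (st z j, ct D z j) (st q j, cst D q j) (st e j, cst D e j))"
    using point_deriv2_diff[OF point_deriv2_affine[OF point_deriv_st[OF Suc_j(1)]]
        point_deriv2_compose[OF f point_deriv_st_ct[OF j]]]
    unfolding vector_pair_expansion(1)[OF f]
    by (simp add: resid_def dresid_def fx_def fu_def diff_diff_eq)
  from point_deriv2_quadratic[OF this sym]
  show ?thesis
    unfolding dyn_curv_def vector_pair_expansion(2)[OF f, symmetric]
    by (simp add: dyn_curv_def wQ_def symmetric_vector_mult[OF sym])
qed

lemma J_deriv2:
  defines "c \<equiv> 1 / (2 * mu D)"
  shows "point_deriv2 D (J D)
    (\<lambda>z e. (\<Sum>j<hor D. st e j \<bullet> lx D z j + cst D e j \<bullet> lu D z j)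
      + st e (hor D) \<bullet> grad (fcost D) (st z (hor D))
      - c * (2 * (st e 0 \<bullet> (matrix_inv (Pcov D) *v (st z 0 - xprior D))))
      - c * (\<Sum>j=1..cur D.
          2 * (- (hx D z j *v st e j) \<bullet> (matrix_inv (Rcov D j) *v innov D z j)))
      - c * (\<Sum>j<hor D.
          2 * (dresid z j e \<bullet> (matrix_inv (Qcov D (Suc j)) *v resid D z (Suc j)))))
    (\<lambda>z q e. (\<Sum>j<hor D. cost_hess z j q e)
      + st e (hor D) \<bullet> (hess (fcost D) (st z (hor D)) *v st q (hor D))
      - c * (2 * (st e 0 \<bullet> (matrix_inv (Pcov D) *v st q 0)))
      - c * (\<Sum>j=1..cur D.
          2 * ((hx D z j *v st e j) \<bullet> (matrix_inv (Rcov D j) *v (hx D z j *v st q j))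
          - st e j \<bullet> (whess (innov D z j v* matrix_inv (Rcov D j)) (meas D j) (st z j) *v st q j)))
      - c * (\<Sum>j<hor D.
          2 * (dresid z j e \<bullet> (matrix_inv (Qcov D (Suc j)) *v dresid z j q) - dyn_curv z j q e)))"
proof -
  have J_eq: "J D = (\<lambda>z. (\<Sum>j<hor D. cost D j (st z j) (ct D z j)) + fcost D (st z (hor D))
      - c * ((st z 0 - xprior D) \<bullet> (matrix_inv (Pcov D) *v (st z 0 - xprior D)))
      - c * (\<Sum>j=1..cur D. innov D z j \<bullet> (matrix_inv (Rcov D j) *v innov D z j))
      - c * (\<Sum>j<hor D. resid D z (Suc j) \<bullet> (matrix_inv (Qcov D (Suc j)) *v resid D z (Suc j))))"
    by (simp add: fun_eq_iff J_def innov_def resid_def c_def)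
  show ?thesis
    unfolding J_eq
    by (intro point_deriv2_diff point_deriv2_add point_deriv2_cmult point_deriv2_sum cost_deriv2
        fcost_deriv2 prior_deriv2 innov_deriv2 resid_deriv2) simp_all
qed

section \<open>Block rows as balances of past and future terms\<close>

context
  fixes z p :: "('x, 'u) point"
begin

definition costate where
  "costate k = (1 / mu D) *\<^sub>R
    (matrix_inv (Qcov D (Suc k)) *v (dresid z k p + resid D z (Suc k)))"

definition innov_force where
  "innov_force k = (1 / mu D) *\<^sub>R (transpose (hx D z k) *v
    (matrix_inv (Rcov D k) *v (innov D z k - hx D z k *v st p k)))"

definition past where
  "past k = (case k of
      0 \<Rightarrow> - ((1 / mu D) *\<^sub>R (matrix_inv (Pcov D) *v (st p 0 - (xprior D - st z 0))))
    | Suc j \<Rightarrow> (if k \<le> cur D then innov_force k else 0) - costate j)"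

text \<open>The measurement curvature inside \<open>lbar_xx\<close> is taken out here because
  \<open>future\<close> adds it at every time, including the horizon, where there is no
  stage.\<close>

definition stage where
  "stage k = lx D z k + (lbar_xx D z k - meas_curv D z k) *v st p k + lbar_xu D z k *v cst D p k
    + transpose (fx D z k) *v costate k"

definition future where
  "future k = (if k < hor D then stage k else
      grad (fcost D) (st z (hor D)) + hess (fcost D) (st z (hor D)) *v st p (hor D))
    + meas_curv D z k *v st p k"

definition control where
  "control k = lu D z k + lbar_uu D z k *v cst D p k + transpose (lbar_xu D z k) *v st p k
    + transpose (fu D z k) *v costate k"

text \<open>The row is the linearised gradient tested on a unit point. Moving the Jacobians off
  \<open>e\<close> by transposition and grouping by time leaves each block of \<open>e\<close>
  paired with one force, from which the block rows can be read off.\<close>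

lemma newton_row_weak:
  "newton_row D z p c \<longleftrightarrow>
    (let e = unit_point c in
      (\<Sum>j<hor D. st e j \<bullet> stage j) + (\<Sum>j<hor D. cst D e j \<bullet> control j)
      - (\<Sum>j<hor D. st e (Suc j) \<bullet> costate j)
      + st e (hor D) \<bullet> (grad (fcost D) (st z (hor D)) + hess (fcost D) (st z (hor D)) *v st p (hor D))
      - st e 0 \<bullet> ((1 / mu D) *\<^sub>R (matrix_inv (Pcov D) *v (st p 0 - (xprior D - st z 0))))
      + (\<Sum>j=1..cur D. st e j \<bullet> (meas_curv D z j *v st p j + innov_force j)) = 0)"
proof -
  note [simp del] = transpose_matrix_vector
  define e where "e = unit_point c"
  define r where "r = 1 / (2 * mu D)"
  have r: "2 * r = 1 / mu D"
    by (simp add: r_def)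
  have stage_terms: "st e j \<bullet> stage j + cst D e j \<bullet> control j - st e (Suc j) \<bullet> costate j
      = (st e j \<bullet> lx D z j + cst D e j \<bullet> lu D z j) + cost_hess z j p e
        - r * (2 * (dresid z j e \<bullet> (matrix_inv (Qcov D (Suc j)) *v resid D z (Suc j))))
        - r * (2 * (dresid z j e \<bullet> (matrix_inv (Qcov D (Suc j)) *v dresid z j p)
            - dyn_curv z j p e))" for j
  proof -
    \<comment> \<open>The gradient part and the Gauss-Newton part share the factor
      \<open>dresid z j e\<close>; together they form the costate, which contains both the residual
      and its linear change.\<close>
    have "r * (2 * (dresid z j e \<bullet> (matrix_inv (Qcov D (Suc j)) *v resid D z (Suc j))))
        + r * (2 * (dresid z j e \<bullet> (matrix_inv (Qcov D (Suc j)) *v dresid z j p)))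
        = dresid z j e \<bullet> costate j"
      by (simp add: costate_def matrix_vector_right_distrib inner_add_right r_def add_divide_distrib)
    also have "\<dots> = st e (Suc j) \<bullet> costate j - st e j \<bullet> (transpose (fx D z j) *v costate j)
        - cst D e j \<bullet> (transpose (fu D z j) *v costate j)"
      by (simp add: dresid_def inner_diff_left inner_transpose)
    finally have 1: "r * (2 * (dresid z j e \<bullet> (matrix_inv (Qcov D (Suc j)) *v resid D z (Suc j))))
        + r * (2 * (dresid z j e \<bullet> (matrix_inv (Qcov D (Suc j)) *v dresid z j p))) = \<dots>" .
    have "st p j \<bullet> (lbar_xu D z j *v cst D e j)
        = cst D e j \<bullet> (transpose (lbar_xu D z j) *v st p j)"
      by (metis inner_commute inner_transpose)
    \<comment> \<open>Curvature of cost and dynamics combines into the barred blocks; the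
      measurement curvature is summed separately over 1..t.\<close>
    then have 2: "cost_hess z j p e + 1 / mu D * dyn_curv z j p e
        = st e j \<bullet> ((lbar_xx D z j - meas_curv D z j) *v st p j)
          + st e j \<bullet> (lbar_xu D z j *v cst D p j)
          + cst D e j \<bullet> (transpose (lbar_xu D z j) *v st p j)
          + cst D e j \<bullet> (lbar_uu D z j *v cst D p j)"
      by (simp add: cost_hess_def dyn_curv_def lbar_xx_def lbar_xu_def lbar_uu_def
          matrix_vector_mult_add_rdistrib inner_add_right scaleR_matrix_vector_assoc[symmetric]
          add_divide_distrib flip: inner_transpose)
    have 3: "r * (2 * (x - y)) = r * (2 * x) - 1 / mu D * y" for x y
      by (simp add: r[symmetric] algebra_simps)
    show ?thesis
      using 1 2 unfolding 3 stage_def control_def by (simp add: inner_add_right)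
  qed
  have innov_terms: "st e j \<bullet> (meas_curv D z j *v st p j + innov_force j)
      = - r * (2 * (- (hx D z j *v st e j) \<bullet> (matrix_inv (Rcov D j) *v innov D z j)))
        - r * (2 * ((hx D z j *v st e j) \<bullet> (matrix_inv (Rcov D j) *v (hx D z j *v st p j))
          - st e j \<bullet> (whess (innov D z j v* matrix_inv (Rcov D j)) (meas D j) (st z j) *v st p j)))"
    if "j \<in> {1..cur D}" for j
    using that
    by (simp add: meas_curv_def innov_force_def r_def inner_transpose[symmetric] inner_add_right
        matrix_vector_mult_diff_distrib inner_diff_right scaleR_matrix_vector_assoc[symmetric]
        add_divide_distrib diff_divide_distrib)
  have prior_terms: "st e 0 \<bullet> ((1 / mu D) *\<^sub>R (matrix_inv (Pcov D) *v (st p 0 - (xprior D - st z 0))))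
      = r * (2 * (st e 0 \<bullet> (matrix_inv (Pcov D) *v (st z 0 - xprior D))))
        + r * (2 * (st e 0 \<bullet> (matrix_inv (Pcov D) *v st p 0)))"
    by (simp add: r_def matrix_vector_mult_diff_distrib inner_diff_right
        add_divide_distrib diff_divide_distrib)
  have stage_sum: "(\<Sum>j<hor D. st e j \<bullet> stage j) + (\<Sum>j<hor D. cst D e j \<bullet> control j)
      - (\<Sum>j<hor D. st e (Suc j) \<bullet> costate j)
      = (\<Sum>j<hor D. st e j \<bullet> lx D z j + cst D e j \<bullet> lu D z j) + (\<Sum>j<hor D. cost_hess z j p e)
        - r * (\<Sum>j<hor D.
            2 * (dresid z j e \<bullet> (matrix_inv (Qcov D (Suc j)) *v resid D z (Suc j))))
        - r * (\<Sum>j<hor D. 2 * (dresid z j e \<bullet> (matrix_inv (Qcov D (Suc j)) *v dresid z j p)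
            - dyn_curv z j p e))"
    unfolding sum_distrib_left sum.distrib[symmetric] sum_subtractf[symmetric] stage_terms ..
  have innov_sum: "(\<Sum>j=1..cur D. st e j \<bullet> (meas_curv D z j *v st p j + innov_force j))
      = - r * (\<Sum>j=1..cur D.
          2 * (- (hx D z j *v st e j) \<bullet> (matrix_inv (Rcov D j) *v innov D z j)))
        - r * (\<Sum>j=1..cur D.
          2 * ((hx D z j *v st e j) \<bullet> (matrix_inv (Rcov D j) *v (hx D z j *v st p j))
          - st e j \<bullet> (whess (innov D z j v* matrix_inv (Rcov D j)) (meas D j) (st z j) *v st p j)))"
    unfolding sum_distrib_left sum_subtractf[symmetric] by (rule sum.cong[OF refl innov_terms])
  show ?thesis
    unfolding newton_row_iff[OF J_deriv2] Let_def e_def[symmetric] prior_terms r_def[symmetric]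
      stage_sum innov_sum inner_add_right[of "st e (hor D)"] mult_minus_left
    by argo
qed

lemma sum_st_unit_State:
  "finite I \<Longrightarrow> (\<Sum>j\<in>I. st (unit_point (State k a)) j \<bullet> f j) = (if k \<in> I then f k $ a else 0)"
  by (simp add: st_unit_State if_distrib[of "\<lambda>v. v \<bullet> _"] inner_axis' cong: if_cong)

lemma newton_rows_State:
  assumes "k \<le> hor D"
  shows "(\<forall>a. newton_row D z p (State k a)) \<longleftrightarrow> past k + future k = 0"
proof -
  have "newton_row D z p (State k a) \<longleftrightarrow> (past k + future k) $ a = 0" for a
  proof -
    \<comment> \<open>Index shift: x_k is the endpoint of the transition from k - 1, so it meets the
      costate of k - 1, and none for k = 0.\<close>
    have costates: "(\<Sum>j<hor D. st (unit_point (State k a)) (Suc j) \<bullet> costate j)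
        = (case k of 0 \<Rightarrow> 0 | Suc j \<Rightarrow> costate j $ a)"
      using assms
      by (cases k) (simp_all add: st_unit_State if_distrib[of "\<lambda>v. v \<bullet> _"] inner_axis' cong: if_cong)
    \<comment> \<open>\<open>future\<close> contains this term at every time, whereas the row sums
      it only over 1..t.\<close>
    have "meas_curv D z k = 0" if "\<not> (1 \<le> k \<and> k \<le> cur D)"
      by (simp only: meas_curv_def that if_False)
    then show ?thesis
      unfolding newton_row_weak Let_def costates sum_st_unit_State[OF finite_lessThan]
        sum_st_unit_State[OF finite_atLeastAtMost]
      using assms cur_le
      by (cases k) (auto simp: st_unit_State cst_unit_State past_def future_def
          inner_axis' algebra_simps)
  qed
  then show ?thesis
    by (simp add: vec_eq_iff)
qed

lemma newton_rows_Control: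
  assumes "cur D \<le> k" and "k < hor D"
  shows "(\<forall>b. newton_row D z p (Control k b)) \<longleftrightarrow> control k = 0"
proof -
  have "newton_row D z p (Control k b) \<longleftrightarrow> control k $ b = 0" for b
    using assms
    by (simp add: newton_row_weak Let_def st_unit_Control cst_unit_Control
        if_distrib[of "\<lambda>v. v \<bullet> _"] inner_axis' cong: if_cong)
  then show ?thesis
    by (simp add: vec_eq_iff)
qed

lemma transpose_meas_curv: "transpose (meas_curv D z k) = meas_curv D z k"
proof (cases "1 \<le> k \<and> k \<le> cur D")
  case True
  then obtain f1 f2 where "twice_diff (meas D k) f1 f2"
    using C2_twice_diff meas_C2 by metis
  with True show ?thesis
    by (simp add: meas_curv_def transpose_scalar transpose_whess)
next
  case False
  then show ?thesis
    by (auto simp: meas_curv_def transpose_def vec_eq_iff)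
qed

lemma transpose_lbar:
  assumes "k < hor D"
  shows "transpose (lbar_xx D z k) = lbar_xx D z k" and "transpose (lbar_uu D z k) = lbar_uu D z k"
proof -
  obtain f1 f2 where f: "twice_diff (\<lambda>(x, u). dyn D k x u) f1 f2"
    using C2_twice_diff[OF dyn_C2[OF assms]] .
  obtain c1 c2 where c: "twice_diff (\<lambda>(x, u). cost D k x u) c1 c2"
    using C2_twice_diff[OF cost_C2[OF assms]] .
  show "transpose (lbar_xx D z k) = lbar_xx D z k"
    by (simp add: lbar_xx_def transpose_add transpose_scalar transpose_meas_curv
        transpose_hess[OF twice_diff_slice1[OF c]] transpose_whess[OF twice_diff_slice1[OF f]])
  show "transpose (lbar_uu D z k) = lbar_uu D z k"
    by (simp add: lbar_uu_def transpose_add transpose_scalar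
        transpose_hess[OF twice_diff_slice2[OF c]] transpose_whess[OF twice_diff_slice2[OF f]])
qed

section \<open>Elimination\<close>

text \<open>The induction also carries the invertibility of P_k; for k = t it comes from
  \<open>forward_step\<close>. The base case is the prior term.\<close>

lemma past_eq:
  assumes inv_P: "\<And>k. k < cur D \<Longrightarrow> invertible (fwdP D z k)"
    and inv_A: "\<And>k. k < cur D \<Longrightarrow> invertible (matrix_inv (fwdP D z k) - mu D *\<^sub>R lbar_xx D z k)"
    and inv_S: "\<And>k. k < cur D \<Longrightarrow> invertible (Sinn D z k (fwdP D z k))"
    and inv_E: "\<And>k. k < cur D \<Longrightarrow> invertible (Emat D z k (fwdP D z k))"
    and rows: "\<And>k. k < cur D \<Longrightarrow> past k + future k = 0"
    and "k \<le> cur D"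
  shows "invertible (fwdP D z k) \<and>
    past k = - ((1 / mu D) *\<^sub>R (matrix_inv (fwdP D z k) *v (st p k - fwdm D z k)))"
  using \<open>k \<le> cur D\<close>
proof (induction k)
  case 0
  then show ?case
    by (simp add: past_def sym_pos_def_invertible Pcov)
next
  case (Suc k)
  note [simp del] = transpose_matrix_vector
  have k: "k < cur D" "k < hor D" "1 \<le> Suc k" "Suc k \<le> hor D" "Suc k \<le> cur D"
    using Suc.prems cur_le by auto
  \<comment> \<open>Controls before t are data, so no control step enters the forward
    elimination.\<close>
  have cst0: "cst D p k = 0"
    using k by (simp add: cst_def)
  let ?w = "resid D z (Suc k)" and ?Qi = "matrix_inv (Qcov D (Suc k))"
  let ?r = "?Qi *v (st p (Suc k) - fx D z k *v st p k + ?w)"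
  have costate: "mu D *\<^sub>R costate k = ?r"
    using mu_pos by (simp add: costate_def dresid_def cst0)
  \<comment> \<open>Multiplied by \<mu>, with the induction hypothesis for \<open>past k\<close>,
    the row of x_k is the hypothesis \<open>stationary\<close> of
    \<open>forward_step\<close>.\<close>
  have "mu D *\<^sub>R (past k + future k) = 0"
    using rows[OF k(1)] by simp
  then have "transpose (fx D z k) *v ?r = matrix_inv (fwdP D z k) *v (st p k - fwdm D z k)
      - mu D *\<^sub>R (lbar_xx D z k *v st p k + lx D z k)"
    using Suc k mu_pos unfolding costate[symmetric]
    by (simp add: future_def stage_def cst0 scaleR_add_right scaleR_diff_right
        matrix_vector_mult_scaleR matrix_vector_mult_diff_rdistrib algebra_simps)
  note step = forward_step[OF inv_P[OF k(1)] inv_A[OF k(1)] inv_E[OF k(1)] inv_S[OF k(1)]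
      sym_pos_def_invertible[OF Qcov[OF k(3,4)]] sym_pos_def_invertible[OF Rcov[OF k(3,5)]]
      Emat_def Pbar_def Sinn_def Kgain_def fwdP.simps(2) fwdm.simps(2) this]
  have "past (Suc k) = - ((1 / mu D) *\<^sub>R (mu D *\<^sub>R costate k
      - transpose (hx D z (Suc k)) *v (matrix_inv (Rcov D (Suc k)) *v
          (innov D z (Suc k) - hx D z (Suc k) *v st p (Suc k)))))"
    using k mu_pos by (simp add: past_def innov_force_def scaleR_diff_right)
  with step show ?case
    unfolding costate by simp
qed

text \<open>Downward induction from the horizon, carrying the symmetry of V_k required by
  \<open>backward_step\<close>. In the base case \<open>meas_curv\<close> occurs on both sides,
  which also covers t = T.\<close>

lemma future_eq:
  assumes inv_Gam: "\<And>k. cur D \<le> k \<Longrightarrow> k < hor D \<Longrightarrow> invertible (Gam D k (bwdV D z (Suc k)))"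
    and inv_Quu: "\<And>k. cur D \<le> k \<Longrightarrow> k < hor D \<Longrightarrow> invertible (Quu D z k (bwdV D z (Suc k)))"
    and states: "\<And>k. cur D < k \<Longrightarrow> k \<le> hor D \<Longrightarrow> past k + future k = 0"
    and controls: "\<And>k. cur D \<le> k \<Longrightarrow> k < hor D \<Longrightarrow> control k = 0"
    and "cur D \<le> k" and "k \<le> hor D"
  shows "transpose (bwdV D z k) = bwdV D z k \<and> future k = bwdV D z k *v st p k + bwdv D z k"
  using \<open>k \<le> hor D\<close> \<open>cur D \<le> k\<close>
proof (induction k rule: inc_induct)
  case base
  obtain f1 f2 where "twice_diff (fcost D) f1 f2"
    using C2_twice_diff[OF fcost_C2] .
  then show ?case
    by (simp add: bwdV.simps[of D z "hor D"] bwdv.simps[of D z "hor D"] future_def transpose_add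
        transpose_meas_curv transpose_hess matrix_vector_mult_add_rdistrib)
next
  case (step k)
  note [simp del] = transpose_matrix_vector
  have k: "cur D \<le> k" "k < hor D" "1 \<le> Suc k" "Suc k \<le> hor D"
    using step by auto
  have V: "transpose (bwdV D z (Suc k)) = bwdV D z (Suc k)"
    and fut: "future (Suc k) = bwdV D z (Suc k) *v st p (Suc k) + bwdv D z (Suc k)"
    using step by auto
  note Q = Qcov[OF k(3,4)]
  \<comment> \<open>Here k + 1 > t, so there is no measurement force, and the row of x_{k+1} equates
    the costate with \<open>future (Suc k)\<close>.\<close>
  have "past (Suc k) = - costate k"
    using k by (simp add: past_def)
  with states[of "Suc k"] k fut
  have r: "costate k = bwdV D z (Suc k) *v st p (Suc k) + bwdv D z (Suc k)"
    by (simp add: add_eq_0_iff)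
  \<comment> \<open>Multiplying the costate by \<mu> Q recovers the linearised dynamics, the
    implicit relation resolved by \<open>\<Gamma>\<close>.\<close>
  have "mu D *\<^sub>R (Qcov D (Suc k) *v costate k) = dresid z k p + resid D z (Suc k)"
    using mu_pos
    by (simp add: costate_def matrix_vector_mult_scaleR
        matrix_inv_cancel[OF sym_pos_def_invertible[OF Q]])
  then have dynamics: "mu D *\<^sub>R (Qcov D (Suc k) *v costate k)
      = st p (Suc k) - fx D z k *v st p k - fu D z k *v cst D p k + resid D z (Suc k)"
    by (simp add: dresid_def)
  have control: "lu D z k + lbar_uu D z k *v cst D p k + transpose (lbar_xu D z k) *v st p k
      + transpose (fu D z k) *v costate k = 0"
    using controls[OF k(1,2)] by (simp add: control_def)
  have Q_sym: "transpose (Qcov D (Suc k)) = Qcov D (Suc k)"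
    using Q unfolding sym_pos_def_def by blast
  have V_eq: "bwdV D z k = lbar_xx D z k
      + transpose (fx D z k) ** matrix_inv (Gam D k (bwdV D z (Suc k))) ** bwdV D z (Suc k) ** fx D z k
      + transpose (Qux D z k (bwdV D z (Suc k)))
        ** (- (matrix_inv (Quu D z k (bwdV D z (Suc k))) ** Qux D z k (bwdV D z (Suc k))))"
    using k(2) by (subst bwdV.simps) (simp add: Ggain_def)
  have v_eq: "bwdv D z k = lx D z k
      + (transpose (fx D z k) ** matrix_inv (Gam D k (bwdV D z (Suc k))))
        *v (bwdv D z (Suc k) - bwdV D z (Suc k) *v resid D z (Suc k))
      + transpose (Qux D z k (bwdV D z (Suc k)))
        *v (- (matrix_inv (Quu D z k (bwdV D z (Suc k)))
          *v Qu D z k (bwdV D z (Suc k)) (bwdv D z (Suc k))))"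
    using k(2) by (subst bwdv.simps) (simp add: gvec_def)
  note step = backward_step[OF V Q_sym transpose_lbar[OF k(2)] inv_Gam[OF k(1,2)]
      inv_Quu[OF k(1,2)] Gam_def Quu_def Qux_def Qu_def V_eq v_eq r dynamics control]
  have "future k = lx D z k + lbar_xx D z k *v st p k + lbar_xu D z k *v cst D p k
      + transpose (fx D z k) *v costate k"
    using k(2) by (simp add: future_def stage_def matrix_vector_mult_diff_rdistrib)
  with step show ?case by simp
qed

end
end

section \<open>Meeting of the two eliminations at the current state\<close>

theorem proposition3:
  fixes D :: "('x::finite, 'u::finite, 'y::finite) problem"
    and z p :: "('x, 'u) point"
  assumes "hor D \<ge> 1" and "cur D \<le> hor D" and "mu D > 0"
    and "\<And>j. j < hor D \<Longrightarrow> C2 (\<lambda>(x, u). dyn D j x u)"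
    and "\<And>j. 1 \<le> j \<Longrightarrow> j \<le> cur D \<Longrightarrow> C2 (meas D j)"
    and "\<And>j. j < hor D \<Longrightarrow> C2 (\<lambda>(x, u). cost D j x u)"
    and "C2 (fcost D)"
    and "sym_pos_def (Pcov D)"
    and "\<And>j. 1 \<le> j \<Longrightarrow> j \<le> hor D \<Longrightarrow> sym_pos_def (Qcov D j)"
    and "\<And>j. 1 \<le> j \<Longrightarrow> j \<le> cur D \<Longrightarrow> sym_pos_def (Rcov D j)"
    and "\<And>k. k < cur D \<Longrightarrow> invertible (fwdP D z k)"
    and "\<And>k. k < cur D \<Longrightarrow> invertible (matrix_inv (fwdP D z k) - mu D *\<^sub>R lbar_xx D z k)"
    and "\<And>k. k < cur D \<Longrightarrow> invertible (Sinn D z k (fwdP D z k))"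
    and "\<And>k. k < cur D \<Longrightarrow> invertible (Emat D z k (fwdP D z k))"
    and "\<And>k. cur D \<le> k \<Longrightarrow> k < hor D \<Longrightarrow> invertible (Gam D k (bwdV D z (Suc k)))"
    and "\<And>k. cur D \<le> k \<Longrightarrow> k < hor D \<Longrightarrow> invertible (Quu D z k (bwdV D z (Suc k)))"
    and "invertible (matrix_inv (fwdP D z (cur D)) - mu D *\<^sub>R bwdV D z (cur D))"
    and "\<And>k a. k < cur D \<Longrightarrow> newton_row D z p (State k a)"
    and "\<And>k a. cur D < k \<Longrightarrow> k \<le> hor D \<Longrightarrow> newton_row D z p (State k a)"
    and "\<And>k b. cur D \<le> k \<Longrightarrow> k < hor D \<Longrightarrow> newton_row D z p (Control k b)"
  shows "(\<forall>a. newton_row D z p (State (cur D) a)) \<longleftrightarrow>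
    st p (cur D) =
      matrix_inv (matrix_inv (fwdP D z (cur D)) - mu D *\<^sub>R bwdV D z (cur D))
        *v (matrix_inv (fwdP D z (cur D)) *v fwdm D z (cur D) + mu D *\<^sub>R bwdv D z (cur D))"
proof -
  interpret smooth_problem D
    using assms(2-10) by unfold_locales
  let ?t = "cur D" and ?P = "fwdP D z (cur D)" and ?V = "bwdV D z (cur D)"
  have rows: "past z p k + future z p k = 0" if "k \<le> hor D" "k \<noteq> ?t" for k
    using that assms(18,19) newton_rows_State[of k z p] by (cases "k < ?t") auto
  have controls: "control z p k = 0" if "?t \<le> k" "k < hor D" for k
    using that assms(20) newton_rows_Control by blast
  \<comment> \<open>For t = 0 this is only the base case of the forward induction; for t = T the
    same holds for the backward one below.\<close>
  have past: "past z p ?t = - ((1 / mu D) *\<^sub>R (matrix_inv ?P *v (st p ?t - fwdm D z ?t)))"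
    using past_eq[of z p ?t] assms(2,11-14) rows by simp
  have future: "future z p ?t = ?V *v st p ?t + bwdv D z ?t"
    using future_eq[of z p ?t] assms(2,15,16) rows controls by simp
  define M where "M = matrix_inv ?P - mu D *\<^sub>R ?V"
  define b where "b = matrix_inv ?P *v fwdm D z ?t + mu D *\<^sub>R bwdv D z ?t"
  have "(\<forall>a. newton_row D z p (State ?t a)) \<longleftrightarrow> mu D *\<^sub>R (past z p ?t + future z p ?t) = 0"
    using newton_rows_State[OF assms(2), of z p] assms(3) by simp
  \<comment> \<open>Scaling by \<mu> turns the row into M p = b, with p the block of the step at
    x_t; invertibility of \<open>M\<close> then makes the equivalence exact.\<close>
  also have "mu D *\<^sub>R (past z p ?t + future z p ?t) = b - M *v st p ?t"
    using assms(3) unfolding past future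
    by (simp add: M_def b_def scaleR_add_right scaleR_diff_right matrix_vector_mult_diff_distrib
        matrix_vector_mult_diff_rdistrib scaleR_matrix_vector_assoc[symmetric])
  also have "\<dots> = 0 \<longleftrightarrow> st p ?t = matrix_inv M *v b"
    using matrix_inv_cancel[of M] assms(17) unfolding M_def[symmetric] by auto
  finally show ?thesis
    by (simp add: M_def b_def)
qed

end
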